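(* Let $n\ge 1$ and let $\Omega$ be a bounded domain with Lipschitz boundary in $\mathbb{R}^{n+1}$. Assume $p\in(1,n+1]$ and that $\beta$ satisfies $$0\le\beta\le\frac{p(n+1)}{n+1-p}\ \text{ if } p<n+1,\qquad \beta\ge 0\ \text{ if } p=n+1.$$ Then there is a positive constant $C=C(n,p,\beta,\Omega)$ such that for all $u\in W^{1,p}_0(\Omega)$, $$\Big(\int_{\Omega}\delta^{-p+\frac{n+1-p}{n+1}\beta}\,|u|^{p+\frac{p\beta}{n+1}}\,dx\Big)^{\frac{n+1}{n+\beta+1}}\le C\int_{\Omega}|\nabla u|^p\,dx .$$
   Context: $\delta=\delta_\Omega(x)=\operatorname{dist}(x,\partial\Omega)$ for $x\in\Omega$ denotes the distance function to the boundary of $\Omega$. *)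

theory Defs
  imports "HOL-Analysis.Analysis"
begin

text \<open>Bounded domains with Lipschitz boundary.  After rotating coordinates so that \<open>e\<close> is the last
  coordinate direction, \<open>y - (y \<bullet> e) *\<^sub>R e\<close> collects the remaining coordinates of \<open>y\<close>, so
  near each boundary point the set is the strict epigraph of a Lipschitz function.\<close>

definition lipschitz_boundary :: "'a::euclidean_space set \<Rightarrow> bool" where
  "lipschitz_boundary \<Omega> \<longleftrightarrow>
     (\<forall>x\<in>frontier \<Omega>. \<exists>r>0. \<exists>e g L. norm e = 1 \<and> L-lipschitz_on {z. z \<bullet> e = 0} g \<and>
        \<Omega> \<inter> ball x r = {y \<in> ball x r. g (y - (y \<bullet> e) *\<^sub>R e) < y \<bullet> e})"

definition bounded_lipschitz_domain :: "'a::euclidean_space set \<Rightarrow> bool" where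
  "bounded_lipschitz_domain \<Omega> \<longleftrightarrow>
     open \<Omega> \<and> connected \<Omega> \<and> \<Omega> \<noteq> {} \<and> bounded \<Omega> \<and> lipschitz_boundary \<Omega>"

abbreviation pderiv_dir :: "('a::euclidean_space \<Rightarrow> real) \<Rightarrow> 'a \<Rightarrow> 'a \<Rightarrow> real" where
  "pderiv_dir f b x \<equiv> frechet_derivative f (at x) b"

definition grad :: "('a::euclidean_space \<Rightarrow> real) \<Rightarrow> 'a \<Rightarrow> 'a" where
  "grad f x = (\<Sum>b\<in>Basis. pderiv_dir f b x *\<^sub>R b)"

primrec C_k :: "nat \<Rightarrow> ('a::euclidean_space \<Rightarrow> real) \<Rightarrow> bool" where
  "C_k 0 f \<longleftrightarrow> continuous_on UNIV f"
| "C_k (Suc k) f \<longleftrightarrow> (\<forall>x. f differentiable (at x)) \<and> (\<forall>b\<in>Basis. C_k k (pderiv_dir f b))"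

text \<open>Elements of $C_c^\infty(\Omega)$, extended by zero to the whole space.\<close>

definition test_functions :: "'a::euclidean_space set \<Rightarrow> ('a \<Rightarrow> real) set" where
  "test_functions \<Omega> = {\<phi>. (\<forall>k. C_k k \<phi>) \<and> compact (closure {x. \<phi> x \<noteq> 0}) \<and>
                            closure {x. \<phi> x \<noteq> 0} \<subseteq> \<Omega>}"

text \<open>Functions are represented by Lebesgue measurable representatives; their values outside
  \<open>\<Omega>\<close> are irrelevant.\<close>

definition Lp_space :: "'a::euclidean_space set \<Rightarrow> real \<Rightarrow> ('a \<Rightarrow> 'b::euclidean_space) set" where
  "Lp_space \<Omega> p = {f. set_borel_measurable lebesgue \<Omega> f \<and>
                       set_integrable lebesgue \<Omega> (\<lambda>x. norm (f x) powr p)}"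

definition Lp_norm :: "'a::euclidean_space set \<Rightarrow> real \<Rightarrow> ('a \<Rightarrow> 'b::euclidean_space) \<Rightarrow> real" where
  "Lp_norm \<Omega> p f = (LINT x:\<Omega>|lebesgue. norm (f x) powr p) powr (1 / p)"

definition locally_integrable :: "'a::euclidean_space set \<Rightarrow> ('a \<Rightarrow> 'b::euclidean_space) \<Rightarrow> bool" where
  "locally_integrable \<Omega> f \<longleftrightarrow> (\<forall>K. compact K \<and> K \<subseteq> \<Omega> \<longrightarrow> set_integrable lebesgue K f)"

definition has_weak_gradient ::
    "'a::euclidean_space set \<Rightarrow> ('a \<Rightarrow> real) \<Rightarrow> ('a \<Rightarrow> 'a) \<Rightarrow> bool" where
  "has_weak_gradient \<Omega> u G \<longleftrightarrow> locally_integrable \<Omega> u \<and> locally_integrable \<Omega> G \<and>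
     (\<forall>\<phi>\<in>test_functions \<Omega>. \<forall>b\<in>Basis.
        (LINT x:\<Omega>|lebesgue. u x * pderiv_dir \<phi> b x) = - (LINT x:\<Omega>|lebesgue. (G x \<bullet> b) * \<phi> x))"

text \<open>A weak gradient is unique up to a null set of \<open>\<Omega>\<close>, so the choice below is immaterial
  wherever only integrals over \<open>\<Omega>\<close> are involved.\<close>

definition weak_grad :: "'a::euclidean_space set \<Rightarrow> ('a \<Rightarrow> real) \<Rightarrow> 'a \<Rightarrow> 'a" where
  "weak_grad \<Omega> u = (SOME G. has_weak_gradient \<Omega> u G)"

text \<open>$W^{1,p}(\Omega)$ and $W^{1,p}_0(\Omega)$, the latter being the closure of
  $C_c^\infty(\Omega)$ in $W^{1,p}(\Omega)$.\<close>

definition sobolev_W1 :: "'a::euclidean_space set \<Rightarrow> real \<Rightarrow> ('a \<Rightarrow> real) set" where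
  "sobolev_W1 \<Omega> p = {u. u \<in> Lp_space \<Omega> p \<and> (\<exists>G. has_weak_gradient \<Omega> u G) \<and>
                         weak_grad \<Omega> u \<in> Lp_space \<Omega> p}"

definition sobolev_W1_0 :: "'a::euclidean_space set \<Rightarrow> real \<Rightarrow> ('a \<Rightarrow> real) set" where
  "sobolev_W1_0 \<Omega> p = {u \<in> sobolev_W1 \<Omega> p.
     \<exists>\<phi>. (\<forall>k. \<phi> k \<in> test_functions \<Omega>) \<and>
       (\<lambda>k. Lp_norm \<Omega> p (\<lambda>x. u x - \<phi> k x)) \<longlonglongrightarrow> 0 \<and>
       (\<lambda>k. Lp_norm \<Omega> p (\<lambda>x. weak_grad \<Omega> u x - grad (\<phi> k) x)) \<longlonglongrightarrow> 0}"

definition bdist :: "'a::euclidean_space set \<Rightarrow> 'a \<Rightarrow> real" where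
  "bdist \<Omega> x = infdist x (frontier \<Omega>)"

end

theory Submission
  imports Defs
begin

text \<open>
  Write \<open>N = n + 1\<close> and \<open>\<delta>\<close> for the distance to the boundary. Two estimates for \<open>C\<^sup>1\<close> functions \<open>u\<close>
  of compact support in \<open>\<Omega>\<close> are combined.

  Hardy's inequality \<open>\<integral> \<delta>\<^bsup>-p\<^esup> |u|\<^sup>p \<le> C \<integral> |\<nabla>u|\<^sup>p\<close>: near a boundary point, the height \<open>t\<close> above the
  Lipschitz graph satisfies \<open>\<partial>\<^sub>e t = 1\<close> and \<open>t \<le> C \<delta>\<close>, and integrating \<open>\<partial>\<^sub>e (t\<^bsup>1-p\<^esup> |\<zeta>u|\<^sup>p)\<close> for a cutoff \<open>\<zeta>\<close>
  bounds \<open>\<integral> t\<^bsup>-p\<^esup> |\<zeta>u|\<^sup>p\<close>. Finitely many boundary balls cover the boundary, and the rest of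
  \<open>\<Omega>\<close> is handled by Poincare's inequality.

  The Gagliardo-Nirenberg inequality \<open>\<parallel>v\<parallel>\<^bsub>N/(N-1)\<^esub> \<le> \<integral> g\<close> for an upper gradient \<open>g\<close> of \<open>v\<close>, applied to
  \<open>v = \<delta>\<^sup>b |u|\<^sup>s\<close>; only the Lipschitz continuity of \<open>\<delta>\<close> enters, so \<open>\<delta>\<close> need not be regularised. For \<open>p < N\<close> the
  choice \<open>b = 0\<close> gives Sobolev's inequality, and Hoelder interpolation with Hardy's inequality gives all
  intermediate exponents. For \<open>p = N\<close> the choice \<open>b = 1 - N\<close> raises the power of \<open>u\<close> against the weight
  \<open>\<delta>\<^bsup>-N\<^esup>\<close> by \<open>N/(N-1)\<close>, so iteration from Hardy's inequality reaches arbitrarily large powers.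

  Fatou's lemma along an almost everywhere convergent subsequence extends the result to \<open>W\<^sub>0\<^bsup>1,p\<^esup>\<close>.
\<close>

section \<open>Iterated integrals over coordinates\<close>

text \<open>\<open>exp\<close> lies above its tangent at the weighted mean \<open>m\<close> of the
  logarithms. Summing the tangent bounds with weights of total 1 cancels the linear terms and leaves
  \<open>exp m\<close>, the geometric mean.\<close>

lemma weighted_arith_geo_mean:
  fixes y :: "'i \<Rightarrow> real"
  assumes "finite J" "y0 > 0" "\<And>j. j \<in> J \<Longrightarrow> y j > 0" "a \<ge> 0" "p \<ge> 0" "a + real (card J) * p = 1"
  shows "y0 powr a * (\<Prod>j\<in>J. y j powr p) \<le> a * y0 + p * (\<Sum>j\<in>J. y j)"
proof -
  define m where "m = a * ln y0 + p * (\<Sum>j\<in>J. ln (y j))"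
  have tangent: "exp m * (1 + ln z - m) \<le> z" if "z > 0" for z
  proof -
    have "exp m * (1 + (ln z - m)) \<le> exp m * exp (ln z - m)"
      by (intro mult_left_mono exp_ge_add_one_self) auto
    also have "\<dots> = z" using that by (simp add: exp_diff)
    finally show ?thesis by (simp add: add_diff_eq)
  qed
  have "(\<Prod>j\<in>J. y j powr p) = exp (\<Sum>j\<in>J. p * ln (y j))"
    using assms(1,3) by (subst exp_sum) (force intro!: prod.cong simp: powr_def)+
  then have "y0 powr a * (\<Prod>j\<in>J. y j powr p) = exp m"
    using assms by (simp add: powr_def m_def exp_add sum_distrib_left)
  also have "\<dots> = a * (exp m * (1 + ln y0 - m)) + p * (\<Sum>j\<in>J. exp m * (1 + ln (y j) - m))"
  proof -
    have "a * (exp m * (1 + ln y0 - m)) + p * (\<Sum>j\<in>J. exp m * (1 + ln (y j) - m))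
        = exp m * ((a + real (card J) * p) * (1 - m) + m)"
      by (simp add: m_def sum_distrib_left[symmetric] sum.distrib sum_subtractf algebra_simps
          flip: sum_distrib_right)
    then show ?thesis by (simp add: assms)
  qed
  also have "\<dots> \<le> a * y0 + p * (\<Sum>j\<in>J. y j)"
    using assms by (intro add_mono mult_left_mono sum_mono tangent) auto
  finally show ?thesis .
qed

lemma integral_pos_continuous:
  fixes f :: "real \<Rightarrow> real"
  assumes "a < b" "continuous_on {a..b} f" "\<And>t. f t > 0"
  shows "integral {a..b} f > 0"
proof -
  have "integral {a..b} f \<noteq> 0"
    using integral_eq_0_iff[OF assms(2,1)] assms by (metis atLeastAtMost_iff less_eq_real_def less_irrefl)
  moreover have "integral {a..b} f \<ge> 0"
    using assms by (intro integral_nonneg integrable_continuous_real) (auto intro: less_imp_le)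
  ultimately show ?thesis by simp
qed

text \<open>Dividing every factor by its integral reduces the claim to the arithmetic-geometric mean
  at each point: the normalised factors have integral 1 and the exponents sum to 1.\<close>

lemma Holder_interval_prod:
  fixes f :: "'i \<Rightarrow> real \<Rightarrow> real"
  assumes J: "finite J" and ab: "a < b"
    and g: "continuous_on {a..b} g" "\<And>t. g t > 0"
    and f: "\<And>j. j \<in> J \<Longrightarrow> continuous_on {a..b} (f j)" "\<And>j t. j \<in> J \<Longrightarrow> f j t > 0"
    and e: "\<theta> \<ge> 0" "p \<ge> 0" "\<theta> + real (card J) * p = 1"
  shows "integral {a..b} (\<lambda>t. g t powr \<theta> * (\<Prod>j\<in>J. f j t powr p))
       \<le> integral {a..b} g powr \<theta> * (\<Prod>j\<in>J. integral {a..b} (f j) powr p)"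
proof -
  define c0 c where "c0 = integral {a..b} g" and "c = (\<lambda>j. integral {a..b} (f j))"
  have c0: "c0 > 0" using g ab by (auto simp: c0_def intro!: integral_pos_continuous)
  have c: "c j > 0" if "j \<in> J" for j
    using f that ab by (auto simp: c_def intro!: integral_pos_continuous)
  define K where "K = c0 powr \<theta> * (\<Prod>j\<in>J. c j powr p)"
  have K: "K > 0" using c0 c unfolding K_def by (intro mult_pos_pos prod_pos) force+
  have le: "g t powr \<theta> * (\<Prod>j\<in>J. f j t powr p) \<le> K * (\<theta> * (g t / c0) + p * (\<Sum>j\<in>J. f j t / c j))" for t
  proof -
    have "(g t / c0) powr \<theta> * (\<Prod>j\<in>J. (f j t / c j) powr p) \<le> \<theta> * (g t / c0) + p * (\<Sum>j\<in>J. f j t / c j)"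
      using c0 c g f e J by (intro weighted_arith_geo_mean) auto
    moreover have "(g t / c0) powr \<theta> * (\<Prod>j\<in>J. (f j t / c j) powr p)
        = (g t powr \<theta> * (\<Prod>j\<in>J. f j t powr p)) / K"
      using c0 c g f by (simp add: powr_divide less_imp_le K_def prod_dividef)
    ultimately show ?thesis using K by (simp add: divide_le_eq mult.commute)
  qed
  have cont: "continuous_on {a..b} (\<lambda>t. g t powr \<theta> * (\<Prod>j\<in>J. f j t powr p))"
    using g f by (intro continuous_intros) (auto dest: less_imp_neq simp: less_imp_neq[symmetric])
  have I: "((\<lambda>t. K * (\<theta> * (g t / c0) + p * (\<Sum>j\<in>J. f j t / c j))) has_integral
      K * (\<theta> * (c0 / c0) + p * (\<Sum>j\<in>J. c j / c j))) {a..b}"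
    unfolding c0_def c_def using g f J
    by (intro has_integral_mult_right has_integral_add has_integral_sum has_integral_divide
        integrable_integral integrable_continuous_real) auto
  have "integral {a..b} (\<lambda>t. g t powr \<theta> * (\<Prod>j\<in>J. f j t powr p))
      \<le> K * (\<theta> * (c0 / c0) + p * (\<Sum>j\<in>J. c j / c j))"
    using le by (intro has_integral_le[OF integrable_integral I] integrable_continuous_real cont)
  also have "\<dots> = K"
  proof -
    have "(\<Sum>j\<in>J. c j / c j) = real (card J)"
      using c by (subst sum.cong[OF refl, of _ _ "\<lambda>_. 1"]) force+
    then show ?thesis using c0 e(3) by (simp add: mult.commute)
  qed
  finally show ?thesis by (simp add: K_def c0_def c_def)
qed

section \<open>Integration over one coordinate and its iteration\<close>

text \<open>The result stays a function on the whole space, constant in direction \<open>i\<close>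
  for \<open>i\<close> in \<open>Basis\<close>. Integrating out a coordinate keeps the type, so
  several coordinates can be treated by recursion on a list.\<close>

definition coord_int :: "real \<Rightarrow> 'a::euclidean_space \<Rightarrow> ('a \<Rightarrow> real) \<Rightarrow> 'a \<Rightarrow> real" where
  "coord_int R i f x = integral {-R..R} (\<lambda>t. f (x + (t - x \<bullet> i) *\<^sub>R i))"

lemma continuous_on_slice:
  fixes f :: "'a::euclidean_space \<Rightarrow> real"
  assumes "continuous_on UNIV f"
  shows "continuous_on S (\<lambda>t. f (x + (t - x \<bullet> i) *\<^sub>R i))"
  by (rule continuous_on_compose2[OF assms]) (auto intro!: continuous_intros)

lemma continuous_on_coord_int:
  assumes "continuous_on UNIV f"
  shows "continuous_on UNIV (coord_int R i f)"
proof -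
  have "continuous_on (UNIV \<times> cbox (-R) R) (\<lambda>(x, t). f (x + (t - x \<bullet> i) *\<^sub>R i))"
    unfolding split_beta by (rule continuous_on_compose2[OF assms]) (auto intro!: continuous_intros)
  from integral_continuous_on_param[OF this] show ?thesis
    by (simp add: coord_int_def[abs_def])
qed

lemma coord_int_pos:
  assumes "continuous_on UNIV f" "\<And>x. f x > 0" "R > 0"
  shows "coord_int R i f x > 0"
  unfolding coord_int_def using assms by (intro integral_pos_continuous continuous_on_slice) auto

lemma coord_int_mono:
  assumes "continuous_on UNIV f" "continuous_on UNIV g" "\<And>x. f x \<le> g x"
  shows "coord_int R i f x \<le> coord_int R i g x"
  unfolding coord_int_def using assms
  by (intro integral_le integrable_continuous_real continuous_on_slice) auto

lemma coord_int_invariant: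
  assumes "i \<in> Basis"
  shows "coord_int R i f (x + s *\<^sub>R i) = coord_int R i f x"
  using assms by (simp add: coord_int_def algebra_simps)

lemma coord_int_commute:
  assumes "continuous_on UNIV f" "i \<in> Basis" "j \<in> Basis" "i \<noteq> j"
  shows "coord_int R i (coord_int R j f) x = coord_int R j (coord_int R i f) x"
proof -
  have ij: "i \<bullet> j = 0" "j \<bullet> i = 0" using assms by (auto simp: inner_Basis)
  have "continuous_on (cbox (-R,-R) (R,R)) (\<lambda>(s, t). f (x + (s - x \<bullet> i) *\<^sub>R i + (t - x \<bullet> j) *\<^sub>R j))"
    unfolding split_beta by (rule continuous_on_compose2[OF assms(1)]) (auto intro!: continuous_intros)
  from integral_swap_continuous[OF this] show ?thesis
    using ij by (simp add: coord_int_def algebra_simps)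
qed

fun iter_int :: "real \<Rightarrow> 'a::euclidean_space list \<Rightarrow> ('a \<Rightarrow> real) \<Rightarrow> 'a \<Rightarrow> real" where
  "iter_int R [] f = f"
| "iter_int R (i # J) f = iter_int R J (coord_int R i f)"

lemma iter_int_mono:
  assumes "continuous_on UNIV f" "continuous_on UNIV g" "\<And>x. f x \<le> g x"
  shows "iter_int R J f x \<le> iter_int R J g x"
  using assms
proof (induction J arbitrary: f g)
  case (Cons i J)
  then show ?case by (auto intro!: Cons.IH continuous_on_coord_int coord_int_mono)
qed simp

text \<open>Hoelder's inequality in the variable \<open>x\<^sub>i\<close> passes from \<open>f\<close> and the coordinates \<open>i # J\<close> to
  \<open>coord_int R i f\<close> and the coordinates \<open>J\<close>. Working with strictly positive functions on a box avoids
  Isabelle's convention \<open>0 powr 0 = 0\<close>.\<close>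

lemma Gagliardo_grid:
  fixes f :: "'a::euclidean_space \<Rightarrow> real"
  assumes "continuous_on UNIV f" "\<And>x. f x > 0" "R > 0" "distinct J" "set J \<subseteq> Basis"
    "p \<ge> 0" "(real (length J) - 1) * p \<le> 1"
  shows "iter_int R J (\<lambda>x. f x powr (1 - (real (length J) - 1) * p) *
           (\<Prod>j\<in>set J. coord_int R j f x powr p)) x \<le> iter_int R J f x powr (1 + p)"
  using assms
proof (induction J arbitrary: f)
  \<comment> \<open>Without coordinates the exponent of \<open>f\<close> is 1 - (0 - 1) p = 1 + p
    and the product is empty, so both sides agree.\<close>
  case Nil
  then show ?case by simp
next
  case (Cons i J)
  define m where "m = real (length J)"
  define F where "F = coord_int R i f"
  have i: "i \<in> Basis" "i \<notin> set J" and J: "set J \<subseteq> Basis" "distinct J" using Cons.prems by auto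
  have F: "continuous_on UNIV F" "\<And>x. F x > 0"
    using Cons.prems by (auto simp: F_def intro!: continuous_on_coord_int coord_int_pos)
  have Aj: "continuous_on UNIV (coord_int R j g)" "coord_int R j g x > 0"
    if "continuous_on UNIV g" "\<And>x. g x > 0" for g x j
    using that Cons.prems by (auto intro!: continuous_on_coord_int coord_int_pos)
  define h where "h = (\<lambda>x. f x powr (1 - m * p) * (\<Prod>j\<in>set J. coord_int R j f x powr p))"
  have nz: "f x \<noteq> 0" "F x \<noteq> 0" "coord_int R j f x \<noteq> 0" "coord_int R j F x \<noteq> 0" for x j
    using Cons.prems(2)[of x] F(2)[of x] Aj(2)[OF Cons.prems(1,2), of j x] Aj(2)[OF F, of j x] by auto
  have conth: "continuous_on UNIV h"
    unfolding h_def using Cons.prems nz by (auto intro!: continuous_intros Aj)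
  \<comment> \<open>\<open>F\<close> is constant in direction \<open>i\<close>, so its power leaves
    the integral in that variable.\<close>
  have pull: "coord_int R i (\<lambda>x. F x powr p * h x) x = F x powr p * coord_int R i h x" for x
  proof -
    have "F (x + s *\<^sub>R i) = F x" for s
      unfolding F_def using i(1) by (rule coord_int_invariant)
    then show ?thesis by (simp add: coord_int_def[of R i])
  qed
  \<comment> \<open>Hoelder in the \<open>i\<close>-th variable with exponent 1 - m p for
    \<open>f\<close> and p for each of the m other factors, of total 1; then the two coordinate
    integrals are interchanged.\<close>
  have hle: "coord_int R i h x \<le> F x powr (1 - m * p) * (\<Prod>j\<in>set J. coord_int R j F x powr p)" for x
  proof -
    have "coord_int R i h x \<le> coord_int R i f x powr (1 - m * p) *
        (\<Prod>j\<in>set J. coord_int R i (coord_int R j f) x powr p)"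
      unfolding h_def coord_int_def[of R i]
      using Cons.prems Aj[OF Cons.prems(1,2)] J
      by (intro Holder_interval_prod continuous_on_slice) (auto simp: m_def distinct_card)
    also have "(\<Prod>j\<in>set J. coord_int R i (coord_int R j f) x powr p) = (\<Prod>j\<in>set J. coord_int R j F x powr p)"
      unfolding F_def using i J Cons.prems(1) by (intro prod.cong refl) (subst coord_int_commute, auto)
    finally show ?thesis by (simp add: F_def)
  qed
  have "iter_int R (i # J) (\<lambda>x. f x powr (1 - (real (length (i # J)) - 1) * p) *
           (\<Prod>j\<in>set (i # J). coord_int R j f x powr p)) x
      = iter_int R J (\<lambda>x. F x powr p * coord_int R i h x) x"
  proof -
    have "(\<lambda>x. f x powr (1 - (real (length (i # J)) - 1) * p) * (\<Prod>j\<in>set (i # J). coord_int R j f x powr p))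
        = (\<lambda>x. F x powr p * h x)"
      using i by (simp add: h_def F_def m_def mult_ac)
    moreover have "coord_int R i (\<lambda>x. F x powr p * h x) = (\<lambda>x. F x powr p * coord_int R i h x)"
      using pull by (rule ext)
    ultimately show ?thesis by simp
  qed
  also have "\<dots> \<le> iter_int R J (\<lambda>x. F x powr (1 - (m - 1) * p) * (\<Prod>j\<in>set J. coord_int R j F x powr p)) x"
  proof (rule iter_int_mono)
    show "F x powr p * coord_int R i h x
        \<le> F x powr (1 - (m - 1) * p) * (\<Prod>j\<in>set J. coord_int R j F x powr p)" for x
    proof -
      have "F x powr p * coord_int R i h x
        \<le> F x powr p * (F x powr (1 - m * p) * (\<Prod>j\<in>set J. coord_int R j F x powr p))"
        by (intro mult_left_mono hle) auto
      also have "\<dots> = F x powr (1 - (m - 1) * p) * (\<Prod>j\<in>set J. coord_int R j F x powr p)"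
        by (simp add: mult.assoc[symmetric] powr_add[symmetric] algebra_simps)
      finally show ?thesis .
    qed
  qed (use nz in \<open>auto intro!: continuous_intros Aj F conth continuous_on_coord_int\<close>)
  also have "\<dots> \<le> iter_int R J F x powr (1 + p)"
    unfolding m_def using Cons.prems F J
    by (intro Cons.IH) (auto simp: algebra_simps)
  finally show ?case by (simp add: F_def)
qed

section \<open>The Gagliardo-Nirenberg inequality\<close>

lemma nn_integral_Icc_continuous:
  fixes h :: "real \<Rightarrow> real"
  assumes "continuous_on {a..b} h" "\<And>t. h t \<ge> 0"
  shows "(\<integral>\<^sup>+t. indicator {a..b} t * ennreal (h t) \<partial>lborel) = ennreal (integral {a..b} h)"
proof -
  have I: "set_integrable lborel {a..b} h"
    using assms(1) by (rule borel_integrable_atLeastAtMost')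
  have "(\<integral>\<^sup>+t. indicator {a..b} t * ennreal (h t) \<partial>lborel) = (\<integral>\<^sup>+t. ennreal (indicator {a..b} t * h t) \<partial>lborel)"
    by (intro nn_integral_cong) (auto simp: indicator_def)
  also have "\<dots> = ennreal (LINT t:{a..b}|lborel. h t)"
    using I assms by (simp add: set_integrable_def set_lebesgue_integral_def nn_integral_eq_integral)
  also have "(LINT t:{a..b}|lborel. h t) = integral {a..b} h"
    using I by (rule set_borel_integral_eq_integral)
  finally show ?thesis .
qed

lemma coord_int_nonneg:
  assumes "continuous_on UNIV f" "\<And>x. f x \<ge> 0"
  shows "coord_int R i f x \<ge> 0"
  unfolding coord_int_def using assms
  by (intro integral_nonneg integrable_continuous_real continuous_on_slice) auto

text \<open>Tonelli's theorem, one coordinate at a time. The point \<open>z\<close> supplies the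
  coordinates outside \<open>J\<close>; nonnegative extended integrals spare the induction any
  integrability side conditions.\<close>

lemma iter_int_eq_nn_integral_PiM:
  fixes f :: "'a::euclidean_space \<Rightarrow> real"
  assumes "continuous_on UNIV f" "\<And>x. f x \<ge> 0" "distinct J" "set J \<subseteq> Basis"
  shows "ennreal (iter_int R J f z) = (\<integral>\<^sup>+x. (\<Prod>b\<in>set J. indicator {-R..R} (x b)) *
      ennreal (f (z + (\<Sum>b\<in>set J. (x b - z \<bullet> b) *\<^sub>R b))) \<partial>(\<Pi>\<^sub>M b\<in>set J. lborel))"
  using assms
proof (induction J arbitrary: f)
  case Nil
  interpret product_sigma_finite "\<lambda>b. lborel :: real measure" ..
  show ?case
    unfolding list.set by (subst nn_integral_empty) auto
next
  case (Cons i J)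
  interpret product_sigma_finite "\<lambda>b. lborel :: real measure" ..
  have i: "i \<in> Basis" "i \<notin> set J" and J: "set J \<subseteq> Basis" "distinct J" using Cons.prems by auto
  have f[measurable]: "f \<in> borel_measurable borel"
    using Cons.prems by (intro borel_measurable_continuous_onI)
  define y where "y = (\<lambda>x. z + (\<Sum>b\<in>set J. (x b - z \<bullet> b) *\<^sub>R b))"
  have yi: "y x \<bullet> i = z \<bullet> i" for x
  proof -
    have "b \<bullet> i = 0" if "b \<in> set J" for b
      using that i J by (auto simp: inner_Basis subset_iff)
    then show ?thesis by (simp add: y_def inner_add_left inner_sum_left)
  qed
  have upd: "z + (\<Sum>b\<in>set (i # J). ((x(i := t)) b - z \<bullet> b) *\<^sub>R b) = y x + (t - y x \<bullet> i) *\<^sub>R i" for x t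
  proof -
    have "(\<Sum>b\<in>set J. ((x(i := t)) b - z \<bullet> b) *\<^sub>R b) = (\<Sum>b\<in>set J. (x b - z \<bullet> b) *\<^sub>R b)"
      using i by (intro sum.cong) auto
    then show ?thesis using i yi by (simp add: y_def)
  qed
  have "ennreal (iter_int R (i # J) f z) = (\<integral>\<^sup>+x. (\<Prod>b\<in>set J. indicator {-R..R} (x b)) *
      ennreal (coord_int R i f (y x)) \<partial>(\<Pi>\<^sub>M b\<in>set J. lborel))"
    unfolding iter_int.simps y_def using Cons.prems
    by (intro Cons.IH) (auto intro!: continuous_on_coord_int coord_int_nonneg)
  also have "\<dots> = (\<integral>\<^sup>+x. (\<integral>\<^sup>+t. (\<Prod>b\<in>set (i # J). indicator {-R..R} ((x(i := t)) b)) *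
      ennreal (f (z + (\<Sum>b\<in>set (i # J). ((x(i := t)) b - z \<bullet> b) *\<^sub>R b))) \<partial>lborel) \<partial>(\<Pi>\<^sub>M b\<in>set J. lborel))"
  proof (intro nn_integral_cong)
    fix x
    have P: "(\<Prod>b\<in>set (i # J). indicator {-R..R} ((x(i := t)) b))
        = (indicator {-R..R} t * (\<Prod>b\<in>set J. indicator {-R..R} (x b)) :: ennreal)" for t
      using i by (simp, intro arg_cong2[where f = "(*)"] prod.cong) auto
    have "(\<integral>\<^sup>+t. (\<Prod>b\<in>set (i # J). indicator {-R..R} ((x(i := t)) b)) *
      ennreal (f (z + (\<Sum>b\<in>set (i # J). ((x(i := t)) b - z \<bullet> b) *\<^sub>R b))) \<partial>lborel)
      = (\<integral>\<^sup>+t. (\<Prod>b\<in>set J. indicator {-R..R} (x b)) * (indicator {-R..R} t *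
          ennreal (f (y x + (t - y x \<bullet> i) *\<^sub>R i))) \<partial>lborel)"
      unfolding upd P by (simp only: mult_ac)
    also have "\<dots> = (\<Prod>b\<in>set J. indicator {-R..R} (x b)) * ennreal (coord_int R i f (y x))"
      using Cons.prems unfolding coord_int_def
      by (subst nn_integral_cmult) (auto simp: nn_integral_Icc_continuous continuous_on_slice)
    finally show "(\<Prod>b\<in>set J. indicator {-R..R} (x b)) * ennreal (coord_int R i f (y x)) =
      (\<integral>\<^sup>+t. (\<Prod>b\<in>set (i # J). indicator {-R..R} ((x(i := t)) b)) *
      ennreal (f (z + (\<Sum>b\<in>set (i # J). ((x(i := t)) b - z \<bullet> b) *\<^sub>R b))) \<partial>lborel)" ..
  qed
  also have "\<dots> = (\<integral>\<^sup>+x. (\<Prod>b\<in>set (i # J). indicator {-R..R} (x b)) *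
      ennreal (f (z + (\<Sum>b\<in>set (i # J). (x b - z \<bullet> b) *\<^sub>R b))) \<partial>(\<Pi>\<^sub>M b\<in>set (i # J). lborel))"
    using i(2) unfolding list.set
    by (subst product_nn_integral_insert) auto
  finally show ?case .
qed

text \<open>Once all coordinates are replaced the base point \<open>z\<close> drops out, and
  \<open>lborel\<close> is the image of the product measure under the map from coordinates to
  vectors.\<close>

lemma iter_int_Basis:
  fixes f :: "'a::euclidean_space \<Rightarrow> real"
  assumes f: "continuous_on UNIV f" "\<And>x. f x \<ge> 0" and J: "distinct J" "set J = Basis"
  shows "iter_int R J f z = (LINT x:cbox (- R *\<^sub>R One) (R *\<^sub>R One)|lborel. f x)"
proof -
  define Q :: "'a set" where "Q = cbox (- R *\<^sub>R One) (R *\<^sub>R One)"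
  have [measurable]: "f \<in> borel_measurable borel"
    using f by (intro borel_measurable_continuous_onI)
  have [measurable]: "Q \<in> sets borel" by (simp add: Q_def)
  have nn: "iter_int R J f z \<ge> 0"
  proof -
    have "g x \<ge> 0 \<Longrightarrow> iter_int R K g x \<ge> 0" if "continuous_on UNIV g" "\<And>x. g x \<ge> 0" for K g x
      using that
    proof (induction K arbitrary: g)
      case (Cons i K)
      then show ?case
        by (auto intro!: Cons.IH continuous_on_coord_int coord_int_nonneg)
    qed auto
    then show ?thesis using f by blast
  qed
  have I: "set_integrable lborel Q f"
    unfolding set_integrable_def Q_def using f(1)
    by (intro borel_integrable_compact compact_cbox) (rule continuous_on_subset, auto)
  have "ennreal (iter_int R J f z) = (\<integral>\<^sup>+x. (\<Prod>b\<in>Basis. indicator {-R..R} (x b)) *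
      ennreal (f (z + (\<Sum>b\<in>Basis. (x b - z \<bullet> b) *\<^sub>R b))) \<partial>(\<Pi>\<^sub>M b\<in>Basis. lborel))"
    using iter_int_eq_nn_integral_PiM[OF f J(1), of R z] J(2) by simp
  also have "\<dots> = (\<integral>\<^sup>+x. indicator Q (\<Sum>b\<in>Basis. x b *\<^sub>R b) * ennreal (f (\<Sum>b\<in>Basis. x b *\<^sub>R b))
      \<partial>(\<Pi>\<^sub>M b\<in>Basis. lborel))"
  proof (intro nn_integral_cong arg_cong2[where f = "(*)"])
    fix x :: "'a \<Rightarrow> real"
    show "ennreal (f (z + (\<Sum>b\<in>Basis. (x b - z \<bullet> b) *\<^sub>R b))) = ennreal (f (\<Sum>b\<in>Basis. x b *\<^sub>R b))"
      by (simp add: scaleR_diff_left sum_subtractf euclidean_representation)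
    have "(\<Sum>b\<in>Basis. x b *\<^sub>R b) \<in> Q \<longleftrightarrow> (\<forall>b\<in>Basis. x b \<in> {-R..R})"
      by (auto simp: Q_def mem_box inner_sum_left_Basis)
    then show "(\<Prod>b\<in>Basis. indicator {-R..R} (x b)) = (indicator Q (\<Sum>b\<in>Basis. x b *\<^sub>R b) :: ennreal)"
      by (auto simp: indicator_def)
  qed
  also have "\<dots> = (\<integral>\<^sup>+x. indicator Q x * ennreal (f x) \<partial>lborel)"
    by (subst lborel_eq, subst nn_integral_distr) auto
  also have "\<dots> = (\<integral>\<^sup>+x. ennreal (indicator Q x * f x) \<partial>lborel)"
    by (intro nn_integral_cong) (auto simp: indicator_def)
  also have "\<dots> = ennreal (LINT x:Q|lborel. f x)"
    using I f by (simp add: set_integrable_def set_lebesgue_integral_def nn_integral_eq_integral)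
  finally show ?thesis
    using nn f unfolding Q_def set_lebesgue_integral_def
    by (subst (asm) ennreal_inj) (auto intro!: integral_nonneg_AE)
qed

text \<open>A substitute for the fundamental theorem of calculus when only a local slope of
  \<open>h\<close> is known. By bisection it suffices that the estimate is additive over adjacent
  intervals and holds on short intervals around each \<open>x\<close>, where \<open>k\<close> stays
  above the constant \<open>m x\<close> by continuity.\<close>

lemma local_slope_imp_integral_bound:
  fixes h k :: "real \<Rightarrow> real"
  assumes ab: "a \<le> b" and k: "continuous_on UNIV k"
    and slope: "\<And>x. \<exists>d>0. \<forall>y. \<bar>y - x\<bar> < d \<longrightarrow> \<bar>h y - h x\<bar> \<le> m x * \<bar>y - x\<bar>"
    and mk: "\<And>x. m x < k x"
  shows "\<bar>h b - h a\<bar> \<le> integral {a..b} k"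
proof -
  have int: "k integrable_on {u..v}" for u v
    using k by (intro integrable_continuous_real) (rule continuous_on_subset, auto)
  have "a \<le> b \<longrightarrow> \<bar>h b - h a\<bar> \<le> integral {a..b} k"
    using ab
  proof (induction rule: Bolzano)
    case (trans a b c)
    then have "integral {a..c} k = integral {a..b} k + integral {b..c} k"
      by (intro Henstock_Kurzweil_Integration.integral_combine[symmetric] int) auto
    with trans show ?case by linarith
  next
    case (local x)
    obtain d1 where d1: "d1 > 0" "\<And>y. \<bar>y - x\<bar> < d1 \<Longrightarrow> \<bar>h y - h x\<bar> \<le> m x * \<bar>y - x\<bar>"
      using slope[of x] by blast
    have "isCont k x" using k by (simp add: continuous_on_eq_continuous_at)
    then obtain d2 where d2: "d2 > 0" "\<And>y. \<bar>y - x\<bar> < d2 \<Longrightarrow> \<bar>k y - k x\<bar> < k x - m x"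
      using mk[of x] unfolding continuous_at_real_range
      by (metis diff_gt_0_iff_gt real_norm_def)
    show ?case
    proof (intro exI[of _ "min d1 d2"] conjI allI impI)
      fix a b assume *: "a \<le> x \<and> x \<le> b \<and> b - a < min d1 d2" "a \<le> b"
      then have "\<bar>h b - h x\<bar> \<le> m x * (b - x)" "\<bar>h a - h x\<bar> \<le> m x * (x - a)"
        using d1(2)[of a] d1(2)[of b] by auto
      then have "\<bar>h b - h a\<bar> \<le> m x * (b - a)" by (auto simp: algebra_simps)
      also have "\<dots> = integral {a..b} (\<lambda>_. m x)" using * by simp
      also have "\<dots> \<le> integral {a..b} k"
      proof (intro integral_le int)
        fix y assume "y \<in> {a..b}"
        then have "\<bar>k y - k x\<bar> < k x - m x" using * by (intro d2) auto
        then show "m x \<le> k y" by linarith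
      qed auto
      finally show "\<bar>h b - h a\<bar> \<le> integral {a..b} k" .
    qed (use d1 d2 in auto)
  qed
  with ab show ?thesis by blast
qed

lemma integrable_continuous_compact_support:
  fixes f :: "'a::euclidean_space \<Rightarrow> real"
  assumes "continuous_on UNIV f" "compact K" "\<And>x. x \<notin> K \<Longrightarrow> f x = 0"
  shows "integrable lborel f"
proof -
  have "integrable lborel (\<lambda>x. indicator K x *\<^sub>R f x)"
    using assms by (intro borel_integrable_compact) (auto intro: continuous_on_subset)
  also have "(\<lambda>x. indicator K x *\<^sub>R f x) = f" using assms(3) by (force simp: indicator_def)
  finally show ?thesis .
qed

text \<open>The upper limit of |v y - v x| / dist y x as y tends to x is at most m. This makes sense
  of an upper gradient at points where v is not differentiable.\<close>

definition slope_le :: "('a::euclidean_space \<Rightarrow> real) \<Rightarrow> 'a \<Rightarrow> real \<Rightarrow> bool" where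
  "slope_le v x m \<longleftrightarrow> (\<forall>\<epsilon>>0. \<exists>d>0. \<forall>y. dist y x < d \<longrightarrow> \<bar>v y - v x\<bar> \<le> (m + \<epsilon>) * dist y x)"

text \<open>The power N/(N-1) of |v| is a product of N copies of |v|^(1/(N-1)), each bounded through
  the integral of the upper gradient along a different coordinate line;
  \<open>Gagliardo_grid\<close> with p = 1/(N-1) integrates this product.\<close>

theorem Gagliardo_Nirenberg:
  fixes v g :: "'a::euclidean_space \<Rightarrow> real"
  assumes dim: "DIM('a) \<ge> 2"
    and v: "continuous_on UNIV v" and g: "continuous_on UNIV g" "\<And>x. g x \<ge> 0"
    and K: "compact K" "\<And>x. x \<notin> K \<Longrightarrow> v x = 0" "\<And>x. x \<notin> K \<Longrightarrow> g x = 0"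
    and slope: "\<And>x. slope_le v x (g x)"
  shows "(LINT x|lborel. \<bar>v x\<bar> powr (DIM('a) / (real DIM('a) - 1)))
      \<le> (LINT x|lborel. g x) powr (DIM('a) / (real DIM('a) - 1))"
proof -
  define N where "N = real DIM('a)"
  have N: "N \<ge> 2" using dim by (simp add: N_def)
  define p where "p = 1 / (N - 1)"
  have p: "p > 0" "(N - 1) * p = 1" "N / (N - 1) = 1 + p" "N / (N - 1) = N * p"
    using N by (auto simp: p_def field_simps)
  obtain R0 where R0: "\<forall>x\<in>K. norm x \<le> R0" using K(1) compact_imp_bounded bounded_iff by metis
  define R where "R = max R0 0 + 1"
  have R: "R > 0" "\<And>x. x \<in> K \<Longrightarrow> norm x < R" using R0 by (fastforce simp: R_def)+
  define Q :: "'a set" where "Q = cbox (- R *\<^sub>R One) (R *\<^sub>R One)"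
  have KQ: "K \<subseteq> Q"
  proof
    fix x assume "x \<in> K"
    then have "\<bar>x \<bullet> b\<bar> \<le> R" if "b \<in> Basis" for b
      using R(2)[of x] Basis_le_norm[OF that, of x] by linarith
    then show "x \<in> Q" by (auto simp: Q_def mem_box abs_le_iff minus_le_iff)
  qed
  obtain J where J: "distinct J" "set J = (Basis :: 'a set)"
    using finite_distinct_list[of "Basis :: 'a set"] by auto
  have lenJ: "real (length J) = N" using J by (simp add: N_def flip: distinct_card)
  have LQ: "(LINT x:Q|lborel. h x) = (LINT x|lborel. h x)" if "\<And>x. x \<notin> K \<Longrightarrow> h x = 0" for h :: "'a \<Rightarrow> real"
    unfolding set_lebesgue_integral_def
    by (intro Bochner_Integration.integral_cong) (use that KQ in \<open>auto simp: indicator_def\<close>)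
  define V where "V = (\<lambda>x. \<bar>v x\<bar> powr (N / (N - 1)))"
  have V: "continuous_on UNIV V" using v N unfolding V_def
    by (intro continuous_on_powr' continuous_intros) (auto simp: field_simps)
  have main: "(LINT x|lborel. V x) \<le> ((LINT x|lborel. g x) + \<epsilon> * measure lborel Q) powr (1 + p)"
    if \<epsilon>: "\<epsilon> > 0" for \<epsilon>
  proof -
    \<comment> \<open>Adding \<epsilon> gives the strict positivity required by the grid inequality,
      and leaves room between the slope bound g + \<epsilon>/2 and f.\<close>
    define f where "f = (\<lambda>x. g x + \<epsilon>)"
    have f: "continuous_on UNIV f" "f x > 0" for x
      using g \<epsilon> by (auto simp: f_def intro!: continuous_intros add_nonneg_pos)
    have vle: "\<bar>v x\<bar> \<le> coord_int R i f x" if i: "i \<in> Basis" for x i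
    proof (cases "x \<in> K")
      case False
      then show ?thesis using coord_int_pos[OF f R(1), of i x] K(2) by simp
    next
      case True
      define h where "h = (\<lambda>t. v (x + (t - x \<bullet> i) *\<^sub>R i))"
      have xi: "- R < x \<bullet> i" "x \<bullet> i < R"
        using R(2)[OF True] Basis_le_norm[OF i, of x] by (auto simp: abs_le_iff)
      \<comment> \<open>The point with \<open>i\<close>-th coordinate -R has norm at least R and so
        lies outside \<open>K\<close>. Hence \<open>v\<close> vanishes there, and the difference of
        \<open>h\<close> below is \<open>v x\<close> itself.\<close>
      have "\<bar>(- R)\<bar> \<le> norm (x + (- R - x \<bullet> i) *\<^sub>R i)"
        using Basis_le_norm[OF i, of "x + (- R - x \<bullet> i) *\<^sub>R i"] i by (simp add: inner_add_left)
      then have "x + (- R - x \<bullet> i) *\<^sub>R i \<notin> K" using R(1) R(2)[of "x + (- R - x \<bullet> i) *\<^sub>R i"] by linarith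
      then have hR: "h (-R) = 0" using K(2) by (simp add: h_def)
      have "\<bar>h (x \<bullet> i) - h (-R)\<bar> \<le> integral {-R..x \<bullet> i} (\<lambda>t. f (x + (t - x \<bullet> i) *\<^sub>R i))"
      proof (rule local_slope_imp_integral_bound)
        fix s
        obtain d where "d > 0" and d: "\<And>y. dist y (x + (s - x \<bullet> i) *\<^sub>R i) < d \<Longrightarrow>
           \<bar>v y - v (x + (s - x \<bullet> i) *\<^sub>R i)\<bar> \<le> (g (x + (s - x \<bullet> i) *\<^sub>R i) + \<epsilon>/2) * dist y (x + (s - x \<bullet> i) *\<^sub>R i)"
          using slope[of "x + (s - x \<bullet> i) *\<^sub>R i"] \<epsilon> unfolding slope_le_def by (meson half_gt_zero)
        have "dist (x + (t - x \<bullet> i) *\<^sub>R i) (x + (s - x \<bullet> i) *\<^sub>R i) = \<bar>t - s\<bar>" for t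
          using i by (simp add: dist_norm flip: scaleR_diff_left)
        with d \<open>d > 0\<close> show "\<exists>d>0. \<forall>t. \<bar>t - s\<bar> < d \<longrightarrow>
            \<bar>h t - h s\<bar> \<le> (g (x + (s - x \<bullet> i) *\<^sub>R i) + \<epsilon>/2) * \<bar>t - s\<bar>"
          unfolding h_def by metis
      qed (use xi \<epsilon> f in \<open>auto simp: f_def intro!: continuous_on_slice[of f, unfolded f_def]\<close>)
      also have "\<dots> \<le> integral {-R..R} (\<lambda>t. f (x + (t - x \<bullet> i) *\<^sub>R i))"
        using xi f by (intro integral_subset_le integrable_continuous_real continuous_on_slice)
          (auto intro: less_imp_le)
      finally show ?thesis using hR by (simp add: h_def coord_int_def)
    qed
    have "V x \<le> f x powr (1 - (real (length J) - 1) * p) * (\<Prod>j\<in>set J. coord_int R j f x powr p)" for x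
    proof -
      have "V x = (\<Prod>j\<in>(Basis :: 'a set). \<bar>v x\<bar> powr p)"
      proof (cases "v x = 0")
        case False
        then have "(\<bar>v x\<bar> powr p) ^ DIM('a) = \<bar>v x\<bar> powr (N * p)"
          by (simp add: powr_realpow[symmetric] powr_powr N_def mult.commute)
        then show ?thesis by (simp add: V_def p(4))
      qed (use dim in \<open>simp add: V_def\<close>)
      also have "\<dots> \<le> (\<Prod>j\<in>set J. coord_int R j f x powr p)"
        unfolding J using vle p by (intro prod_mono) (auto intro!: powr_mono2)
      \<comment> \<open>Here 1 - (N - 1) p = 0, and the power 0 of \<open>f x\<close> is 1 because
        \<open>f x\<close> is positive.\<close>
      finally show ?thesis using f(2)[of x] by (simp add: lenJ p)
    qed
    then have "iter_int R J V 0 \<le> iter_int R J (\<lambda>x. f x powr (1 - (real (length J) - 1) * p) *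
          (\<Prod>j\<in>set J. coord_int R j f x powr p)) 0"
    proof (intro iter_int_mono V)
      have "f x \<noteq> 0" "coord_int R j f x \<noteq> 0" for x j
        using f(2)[of x] coord_int_pos[OF f R(1), of j x] by auto
      then show "continuous_on UNIV (\<lambda>x. f x powr (1 - (real (length J) - 1) * p) *
          (\<Prod>j\<in>set J. coord_int R j f x powr p))"
        using f by (auto intro!: continuous_intros continuous_on_coord_int)
    qed auto
    also have "\<dots> \<le> iter_int R J f 0 powr (1 + p)"
      using f R J p by (intro Gagliardo_grid) (auto simp: lenJ)
    also have "iter_int R J f 0 = (LINT x:Q|lborel. f x)"
      unfolding Q_def using f J by (intro iter_int_Basis) (auto intro: less_imp_le)
    also have "\<dots> = (LINT x:Q|lborel. g x) + (LINT x:Q|lborel. \<epsilon>)"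
      unfolding f_def Q_def
      by (intro set_integral_add; unfold set_integrable_def)
        (auto intro!: borel_integrable_compact[OF compact_cbox] continuous_on_subset[OF g(1)] simp del: real_scaleR_def)
    also have "(LINT x:Q|lborel. g x) = (LINT x|lborel. g x)" using K by (intro LQ)
    also have "(LINT x:Q|lborel. \<epsilon>) = \<epsilon> * measure lborel Q"
      by (simp add: set_lebesgue_integral_def mult.commute Q_def)
    also have "iter_int R J V 0 = (LINT x:Q|lborel. V x)"
      unfolding Q_def using V J by (intro iter_int_Basis) (auto simp: V_def)
    also have "\<dots> = (LINT x|lborel. V x)" using K by (intro LQ) (simp add: V_def)
    finally show ?thesis .
  qed
  have "((\<lambda>\<epsilon>. ((LINT x|lborel. g x) + \<epsilon> * measure lborel Q) powr (1 + p)) \<longlongrightarrow>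
      ((LINT x|lborel. g x) + 0 * measure lborel Q) powr (1 + p)) (at_right 0)"
  proof (rule tendsto_powr2)
    show "\<forall>\<^sub>F \<epsilon> in at_right 0. 0 \<le> (LINT x|lborel. g x) + \<epsilon> * measure lborel Q"
      using g by (intro eventually_at_rightI[of 0 1]) (auto intro!: add_nonneg_nonneg integral_nonneg_AE)
    show "((\<lambda>\<epsilon>. (LINT x|lborel. g x) + \<epsilon> * measure lborel Q) \<longlongrightarrow>
        (LINT x|lborel. g x) + 0 * measure lborel Q) (at_right 0)"
      by (intro tendsto_intros)
  qed (use p in auto)
  then have "(LINT x|lborel. V x) \<le> ((LINT x|lborel. g x) + 0 * measure lborel Q) powr (1 + p)"
    by (rule tendsto_lowerbound) (auto intro!: eventually_at_rightI[of 0 1] main)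
  then show ?thesis by (simp add: V_def N_def[symmetric] p(3))
qed

section \<open>Directional derivatives and weighted Hardy inequalities\<close>

text \<open>Young's inequality for both functions divided by their integrals. If an integral is 0,
  that function vanishes almost everywhere and both sides are 0; with \<open>0 powr 0 = 0\<close>
  this includes the exponent 0.\<close>

lemma Holder_integral:
  fixes f g :: "'a \<Rightarrow> real"
  assumes f: "integrable M f" "\<And>x. f x \<ge> 0" and g: "integrable M g" "\<And>x. g x \<ge> 0"
    and \<theta>: "\<theta> \<ge> 0" "\<eta> \<ge> 0" "\<theta> + \<eta> = 1"
  shows "integrable M (\<lambda>x. f x powr \<theta> * g x powr \<eta>)"
    and "(LINT x|M. f x powr \<theta> * g x powr \<eta>) \<le> (LINT x|M. f x) powr \<theta> * (LINT x|M. g x) powr \<eta>"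
proof -
  have Y: "a powr \<theta> * b powr \<eta> \<le> \<theta> * a + \<eta> * b" if "a \<ge> 0" "b \<ge> 0" for a b :: real
    using Youngs_inequality_0[OF \<theta>, of a b] that \<theta> by (cases "a = 0 \<or> b = 0") auto
  show I: "integrable M (\<lambda>x. f x powr \<theta> * g x powr \<eta>)"
  proof (rule Bochner_Integration.integrable_bound)
    show "integrable M (\<lambda>x. \<theta> * f x + \<eta> * g x)" using f g by auto
    show "(\<lambda>x. f x powr \<theta> * g x powr \<eta>) \<in> borel_measurable M"
      using f g by (auto intro!: borel_measurable_times)
    show "AE x in M. norm (f x powr \<theta> * g x powr \<eta>) \<le> norm (\<theta> * f x + \<eta> * g x)"
      using Y f g \<theta> by (intro AE_I2) auto
  qed
  define a b where "a = (LINT x|M. f x)" and "b = (LINT x|M. g x)"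
  have ab: "a \<ge> 0" "b \<ge> 0" using f g by (auto simp: a_def b_def)
  show "(LINT x|M. f x powr \<theta> * g x powr \<eta>) \<le> a powr \<theta> * b powr \<eta>"
  proof (cases "a = 0 \<or> b = 0")
    case True
    then have "AE x in M. f x = 0 \<or> g x = 0"
    proof
      assume "a = 0"
      then have "AE x in M. f x = 0"
        using f integral_nonneg_eq_0_iff_AE[OF f(1)] by (simp add: a_def)
      then show ?thesis by auto
    next
      assume "b = 0"
      then have "AE x in M. g x = 0"
        using g integral_nonneg_eq_0_iff_AE[OF g(1)] by (simp add: b_def)
      then show ?thesis by auto
    qed
    then have "AE x in M. f x powr \<theta> * g x powr \<eta> = 0" by auto
    then have "(LINT x|M. f x powr \<theta> * g x powr \<eta>) = 0" by (rule integral_eq_zero_AE)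
    then show ?thesis by simp
  next
    case False
    then have pos: "a > 0" "b > 0" using ab by auto
    have "(LINT x|M. f x powr \<theta> * g x powr \<eta>)
        \<le> (LINT x|M. a powr \<theta> * b powr \<eta> * (\<theta> * (f x / a) + \<eta> * (g x / b)))"
    proof (intro integral_mono I)
      show "f x powr \<theta> * g x powr \<eta> \<le> a powr \<theta> * b powr \<eta> * (\<theta> * (f x / a) + \<eta> * (g x / b))" for x
        using Y[of "f x / a" "g x / b"] f(2)[of x] g(2)[of x] pos by (simp add: powr_divide field_simps)
    qed (use f g in auto)
    also have "\<dots> = a powr \<theta> * b powr \<eta> * (\<theta> * (a / a) + \<eta> * (b / b))"
      using f g by (simp add: a_def b_def)
    also have "\<dots> = a powr \<theta> * b powr \<eta>" using pos \<theta> by simp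
    finally show ?thesis .
  qed
qed

text \<open>Absorption of the quantity \<open>A\<close>: when it is positive, divide by
  \<open>A powr (1 - 1 / p)\<close> and raise to the power p.\<close>

lemma le_if_le_Holder:
  fixes A B D p :: real
  assumes "A \<ge> 0" "B \<ge> 0" "D \<ge> 0" "p > 0" "A \<le> D * (A powr (1 - 1 / p) * B powr (1 / p))"
  shows "A \<le> D powr p * B"
proof (cases "A = 0")
  case False
  then have A: "A > 0" using assms by simp
  have "A powr (1 - 1 / p) * A powr (1 / p) \<le> A powr (1 - 1 / p) * (D * B powr (1 / p))"
    using assms A by (simp add: powr_add[symmetric] mult_ac)
  then have "A powr (1 / p) \<le> D * B powr (1 / p)" using A by simp
  then have "(A powr (1 / p)) powr p \<le> (D * B powr (1 / p)) powr p"
    using assms by (intro powr_mono2) auto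
  then show ?thesis using assms A by (simp add: powr_powr powr_mult)
qed (use assms in simp)

text \<open>\<open>U\<close> and the complement of \<open>K\<close> are open, cover the space, and
  carry continuous restrictions of \<open>f\<close>.\<close>

lemma continuous_on_UNIV_extend_zero:
  fixes f :: "'a::metric_space \<Rightarrow> 'b::real_normed_vector"
  assumes "open U" "closed K" "K \<subseteq> U" "continuous_on U f" "\<And>x. x \<notin> K \<Longrightarrow> f x = 0"
  shows "continuous_on UNIV f"
proof -
  have "continuous_on (- K) f"
    using assms(5) by (subst continuous_on_cong[of _ _ _ "\<lambda>_. 0"]) auto
  then have "continuous_on (U \<union> - K) f"
    using assms by (intro continuous_on_open_Un) auto
  moreover have "U \<union> - K = UNIV" using assms by auto
  ultimately show ?thesis by simp
qed

lemma lborel_integral_translate: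
  fixes F :: "'a::euclidean_space \<Rightarrow> real"
  assumes "integrable lborel F"
  shows "integrable lborel (\<lambda>x. F (a + x))" "(LINT x|lborel. F (a + x)) = (LINT x|lborel. F x)"
proof -
  have d: "lborel = distr lborel borel (\<lambda>x::'a. a + x)"
    using lborel_affine[of 1 a] by (simp add: density_1)
  have [measurable]: "F \<in> borel_measurable borel" using assms by auto
  show "integrable lborel (\<lambda>x. F (a + x))"
    using assms by (subst (asm) d) (auto simp: integrable_distr_eq)
  show "(LINT x|lborel. F (a + x)) = (LINT x|lborel. F x)"
    by (subst (2) d) (auto simp: integral_distr)
qed

section \<open>Directional derivatives and integration by parts\<close>

text \<open>Differentiability along a single line suits the height above a Lipschitz graph: it grows
  at unit speed in direction e but may fail to be differentiable in others.\<close>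

definition has_dir_deriv :: "('a::real_normed_vector \<Rightarrow> real) \<Rightarrow> 'a \<Rightarrow> real \<Rightarrow> 'a \<Rightarrow> bool" where
  "has_dir_deriv F e D x \<longleftrightarrow> ((\<lambda>\<tau>. F (x + \<tau> *\<^sub>R e)) has_real_derivative D) (at 0)"

lemma has_dir_deriv_line:
  assumes "has_dir_deriv F e D (x + \<tau> *\<^sub>R e)"
  shows "((\<lambda>\<tau>. F (x + \<tau> *\<^sub>R e)) has_real_derivative D) (at \<tau>)"
  using assms DERIV_shift[of "\<lambda>\<tau>. F (x + \<tau> *\<^sub>R e)" D 0 \<tau>]
  by (simp add: has_dir_deriv_def algebra_simps)

text \<open>Every difference quotient has integral 0 by translation invariance, and dominated
  convergence passes to the derivative.\<close>

lemma integral_dir_deriv_eq_0: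
  fixes F F' :: "'a::euclidean_space \<Rightarrow> real"
  assumes F: "continuous_on UNIV F" and F': "continuous_on UNIV F'"
    and K: "compact K" "\<And>x. x \<notin> K \<Longrightarrow> F x = 0" "\<And>x. x \<notin> K \<Longrightarrow> F' x = 0"
    and D: "\<And>x. has_dir_deriv F e (F' x) x"
  shows "(LINT x|lborel. F' x) = 0"
proof -
  have [measurable]: "F \<in> borel_measurable borel" "F' \<in> borel_measurable borel"
    using F F' by (auto intro: borel_measurable_continuous_onI)
  obtain B where B: "\<And>x. x \<in> K \<Longrightarrow> norm x \<le> B"
    using K(1) compact_imp_bounded bounded_iff by metis
  have "compact (F' ` K)" using K F' by (intro compact_continuous_image) (auto intro: continuous_on_subset)
  then obtain M0 where M0: "\<And>x. x \<in> K \<Longrightarrow> \<bar>F' x\<bar> \<le> M0"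
    using compact_imp_bounded bounded_iff by (metis image_eqI real_norm_def)
  define M where "M = max M0 0"
  have M: "\<bar>F' x\<bar> \<le> M" "M \<ge> 0" for x using M0 K(3) by (cases "x \<in> K"; force simp: M_def)+
  \<comment> \<open>Step lengths at most 1 keep all difference quotients supported in one ball of
    radius B + norm e.\<close>
  define h where "h = (\<lambda>n::nat. 1 / real (Suc n))"
  have h: "h n > 0" "h n \<le> 1" for n by (auto simp: h_def)
  have h0: "h \<longlonglongrightarrow> 0" unfolding h_def using LIMSEQ_inverse_real_of_nat by (simp add: inverse_eq_divide)
  define S where "S = (\<lambda>n x. (F (h n *\<^sub>R e + x) - F x) / h n)"
  have intF: "integrable lborel F" using F K by (intro integrable_continuous_compact_support) auto
  have S0: "(LINT x|lborel. S n x) = 0" for n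
    unfolding S_def using lborel_integral_translate[OF intF] intF by simp
  have "(\<lambda>n. LINT x|lborel. S n x) \<longlonglongrightarrow> (LINT x|lborel. F' x)"
  proof (rule integral_dominated_convergence)
    show "integrable lborel (\<lambda>x::'a. M * indicator (cball 0 (B + norm e)) x)"
      using emeasure_lborel_cball_finite[of "0::'a"] by (intro integrable_mult_right integrable_real_indicator) auto
    show "AE x in lborel. (\<lambda>n. S n x) \<longlonglongrightarrow> F' x"
    proof (intro AE_I2)
      fix x
      have "((\<lambda>\<tau>. (F (x + \<tau> *\<^sub>R e) - F x) / \<tau>) \<longlongrightarrow> F' x) (at 0)"
        using D[of x] by (simp add: has_dir_deriv_def has_field_derivative_iff)
      moreover have "filterlim h (at 0) sequentially"
        using h h0 by (auto simp: filterlim_at less_imp_neq[symmetric] intro!: always_eventually)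
      ultimately have "((\<lambda>n. (F (x + h n *\<^sub>R e) - F x) / h n) \<longlongrightarrow> F' x) sequentially"
        by (rule filterlim_compose)
      then show "(\<lambda>n. S n x) \<longlonglongrightarrow> F' x" by (simp add: S_def add.commute)
    qed
    show "AE x in lborel. norm (S n x) \<le> M * indicator (cball 0 (B + norm e)) x" for n
    proof (intro AE_I2)
      fix x :: 'a
      show "norm (S n x) \<le> M * indicator (cball 0 (B + norm e)) x"
      proof (cases "norm x \<le> B + norm e")
        case False
        have "x \<notin> K" using B[of x] False norm_ge_zero[of e] by linarith
        moreover have "h n *\<^sub>R e + x \<notin> K"
        proof
          assume "h n *\<^sub>R e + x \<in> K"
          then have "norm (h n *\<^sub>R e + x) \<le> B" by (rule B)
          moreover have "norm x \<le> norm (h n *\<^sub>R e + x) + norm (h n *\<^sub>R e)"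
            by (metis add_diff_cancel_left' norm_triangle_ineq4)
          moreover have "norm (h n *\<^sub>R e) \<le> norm e" using h[of n] by (simp add: mult_left_le_one_le)
          ultimately show False using False by linarith
        qed
        ultimately show ?thesis using K(2) M(2) by (simp add: S_def)
      next
        case True
        \<comment> \<open>The mean value theorem turns the difference quotient into a value of
          \<open>F'\<close>, which is bounded by \<open>M\<close>.\<close>
        have "\<exists>z>0. z < h n \<and> F (x + h n *\<^sub>R e) - F (x + 0 *\<^sub>R e) = (h n - 0) * F' (x + z *\<^sub>R e)"
          using h[of n] D by (intro MVT2 has_dir_deriv_line)
        then obtain z where "F (x + h n *\<^sub>R e) - F x = h n * F' (x + z *\<^sub>R e)" by auto
        then have "S n x = F' (x + z *\<^sub>R e)" using h[of n] by (simp add: S_def add.commute)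
        then show ?thesis using M True by simp
      qed
    qed
  qed (auto simp: S_def)
  then show ?thesis by (simp add: S0 LIMSEQ_const_iff)
qed

text \<open>The function is the r-th power of the positive part minus that of the negative part, and
  both are continuous since r > 0.\<close>

lemma continuous_on_sgn_powr:
  fixes f :: "'a::topological_space \<Rightarrow> real"
  assumes "r > 0" "continuous_on S f"
  shows "continuous_on S (\<lambda>x. sgn (f x) * \<bar>f x\<bar> powr r)"
proof -
  have *: "(\<lambda>x. sgn (f x) * \<bar>f x\<bar> powr r) = (\<lambda>x. max (f x) 0 powr r - max (- f x) 0 powr r)"
    by (auto simp: sgn_if fun_eq_iff)
  show ?thesis
    unfolding * using assms by (auto intro!: continuous_on_diff continuous_on_powr' continuous_on_max continuous_on_minus continuous_on_const)
qed

text \<open>The delicate point is s = 0: the difference quotient there is sgn h |h|^(p-1), which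
  tends to 0 because p > 1.\<close>

lemma DERIV_abs_powr:
  fixes s :: real
  assumes "p > 1"
  shows "((\<lambda>s. \<bar>s\<bar> powr p) has_real_derivative p * (sgn s * \<bar>s\<bar> powr (p - 1))) (at s)"
proof -
  consider "s > 0" | "s < 0" | "s = 0" by linarith
  then show ?thesis
  proof cases
    case 1
    have "((\<lambda>s. s powr p) has_real_derivative p * s powr (p - 1)) (at s)"
      using 1 by (rule has_real_derivative_powr)
    then have "((\<lambda>s. \<bar>s\<bar> powr p) has_real_derivative p * s powr (p - 1)) (at s)"
      by (rule has_field_derivative_transform_within_open[where S = "{0<..}"]) (use 1 in auto)
    then show ?thesis using 1 by simp
  next
    case 2
    have "((\<lambda>s. (- s) powr p) has_real_derivative p * (- s) powr (p - 1) * - 1) (at s)"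
      using 2 by (auto intro!: derivative_eq_intros)
    then have "((\<lambda>s. \<bar>s\<bar> powr p) has_real_derivative p * (- s) powr (p - 1) * - 1) (at s)"
      by (rule has_field_derivative_transform_within_open[where S = "{..<0}"]) (use 2 in auto)
    then show ?thesis using 2 by simp
  next
    case 3
    have "continuous_on UNIV (\<lambda>h::real. sgn h * \<bar>h\<bar> powr (p - 1))"
      using assms by (intro continuous_on_sgn_powr) auto
    then have "((\<lambda>h. sgn h * \<bar>h\<bar> powr (p - 1)) \<longlongrightarrow> 0) (at (0::real))"
      by (auto simp: continuous_on_def dest: spec[of _ 0])
    moreover have "\<forall>\<^sub>F h in at (0::real). sgn h * \<bar>h\<bar> powr (p - 1) = \<bar>h\<bar> powr p / h"
    proof -
      have "sgn h * \<bar>h\<bar> powr (p - 1) = \<bar>h\<bar> powr p / h" if "h \<noteq> 0" for h :: real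
        using that by (auto simp: powr_diff sgn_if)
      then show ?thesis by (auto simp: eventually_at_filter)
    qed
    ultimately have "((\<lambda>h. \<bar>h\<bar> powr p / h) \<longlongrightarrow> 0) (at (0::real))"
      by (rule Lim_transform_eventually)
    then show ?thesis using 3 assms by (simp add: has_field_derivative_iff)
  qed
qed

text \<open>Integrating \<open>\<partial>\<^sub>e (|w|\<^sup>p \<phi>)\<close> gives \<open>\<integral> |w|\<^sup>p \<phi>' = - p \<integral> |w|\<^bsup>p-1\<^esup> sgn w \<partial>\<^sub>e w \<phi>\<close>;
  the hypothesis on \<open>\<phi>\<close> is what lets the right-hand side be absorbed by Hoelder's inequality.\<close>

lemma weighted_Hardy:
  fixes w w' \<phi> \<phi>' :: "'a::euclidean_space \<Rightarrow> real"
  assumes p: "p > 1" and w: "continuous_on UNIV w" "continuous_on UNIV w'" "\<And>x. has_dir_deriv w e (w' x) x"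
    and K: "compact K" "\<And>x. x \<notin> K \<Longrightarrow> w x = 0" "\<And>x. x \<notin> K \<Longrightarrow> w' x = 0"
    and U: "open U" "K \<subseteq> U"
    and \<phi>: "continuous_on U \<phi>" "continuous_on U \<phi>'" "\<And>x. x \<in> U \<Longrightarrow> has_dir_deriv \<phi> e (\<phi>' x) x"
    and \<phi>'0: "\<And>x. x \<in> U \<Longrightarrow> \<phi>' x \<ge> 0"
    and bound: "\<And>x. x \<in> U \<Longrightarrow> \<bar>\<phi> x\<bar> \<le> c * \<phi>' x powr (1 - 1 / p)" and c: "c \<ge> 0"
  shows "integrable lborel (\<lambda>x. \<bar>w x\<bar> powr p * \<phi>' x)"
    and "(LINT x|lborel. \<bar>w x\<bar> powr p * \<phi>' x) \<le> (p * c) powr p * (LINT x|lborel. \<bar>w' x\<bar> powr p)"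
proof -
  note ext = continuous_on_UNIV_extend_zero[OF U(1) compact_imp_closed[OF K(1)] U(2)]
  have wU: "continuous_on U w" "continuous_on U w'" using w by (auto intro: continuous_on_subset)
  define s where "s = (\<lambda>x. sgn (w x) * \<bar>w x\<bar> powr (p - 1))"
  have s: "continuous_on U s" unfolding s_def using p wU by (intro continuous_on_sgn_powr) auto
  have wp: "continuous_on U (\<lambda>x. \<bar>w x\<bar> powr p)" "continuous_on UNIV (\<lambda>x. \<bar>w' x\<bar> powr p)"
    using p wU w by (auto intro!: continuous_on_powr' continuous_on_rabs continuous_on_const)
  define F where "F = (\<lambda>x. \<bar>w x\<bar> powr p * \<phi> x)"
  define P where "P = (\<lambda>x. p * s x * w' x * \<phi> x)"
  define Q where "Q = (\<lambda>x. \<bar>w x\<bar> powr p * \<phi>' x)"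
  have cont: "continuous_on UNIV F" "continuous_on UNIV P" "continuous_on UNIV Q"
    unfolding F_def P_def Q_def using K(2,3)
    by (intro ext continuous_on_mult continuous_on_const wU s wp \<phi>; simp)+
  have zero: "F x = 0" "P x = 0" "Q x = 0" if "x \<notin> K" for x
    using that K p by (auto simp: F_def P_def Q_def)
  have intP: "integrable lborel P" and intQ: "integrable lborel Q"
    and intw': "integrable lborel (\<lambda>x. \<bar>w' x\<bar> powr p)"
    using cont zero K wp by (auto intro!: integrable_continuous_compact_support[OF _ K(1)])
  have Qnn: "Q x \<ge> 0" for x using \<phi>'0[of x] zero(3)[of x] U by (cases "x \<in> U"; cases "x \<in> K") (auto simp: Q_def)
  \<comment> \<open>P + Q is the derivative of F along e: by the product rule on \<open>U\<close>,
    and outside \<open>U\<close> because F vanishes near such a point.\<close>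
  have "(LINT x|lborel. P x + Q x) = 0"
  proof (rule integral_dir_deriv_eq_0[of F])
    fix x
    show "has_dir_deriv F e (P x + Q x) x"
    proof (cases "x \<in> U")
      case True
      have "((\<lambda>\<tau>. \<bar>w (x + \<tau> *\<^sub>R e)\<bar> powr p) has_real_derivative p * s x * w' x) (at 0)"
        using DERIV_chain2[OF DERIV_abs_powr[OF p] w(3)[of x, unfolded has_dir_deriv_def], simplified]
        by (simp add: s_def mult_ac)
      from DERIV_mult[OF this \<phi>(3)[OF True, unfolded has_dir_deriv_def]]
      show ?thesis by (simp add: has_dir_deriv_def F_def P_def Q_def algebra_simps)
    next
      case False
      then have x: "x \<notin> K" using U by auto
      have "open ((\<lambda>\<tau>. x + \<tau> *\<^sub>R e) -` (- K))"
        using K(1) by (intro open_vimage) (auto intro!: continuous_intros compact_imp_closed)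
      then have "((\<lambda>\<tau>. F (x + \<tau> *\<^sub>R e)) has_real_derivative 0) (at 0)"
        by (intro has_field_derivative_transform_within_open[OF DERIV_const[of 0]])
           (use x zero in auto)
      then show ?thesis using zero x by (simp add: has_dir_deriv_def)
    qed
  qed (use cont zero K in \<open>auto intro!: continuous_intros\<close>)
  then have "(LINT x|lborel. Q x) = - (LINT x|lborel. P x)" using intP intQ by simp
  also have "\<dots> = (LINT x|lborel. - P x)" by simp
  \<comment> \<open>The bound on \<phi> supplies the factor \<phi>'^(1-1/p), which together with
    |w|^(p-1) makes the power 1 - 1/p of Q.\<close>
  also have "\<dots> \<le> (LINT x|lborel. p * c * (Q x powr (1 - 1 / p) * (\<bar>w' x\<bar> powr p) powr (1 / p)))"
  proof (intro integral_mono)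
    show "integrable lborel (\<lambda>x. p * c * (Q x powr (1 - 1 / p) * (\<bar>w' x\<bar> powr p) powr (1 / p)))"
      using p intQ intw' Qnn by (intro integrable_mult_right Holder_integral) auto
    fix x
    show "- P x \<le> p * c * (Q x powr (1 - 1 / p) * (\<bar>w' x\<bar> powr p) powr (1 / p))"
    proof (cases "x \<in> U")
      case True
      have "\<bar>s x\<bar> \<le> (\<bar>w x\<bar> powr p) powr (1 - 1 / p)"
        using p by (cases "w x = 0") (auto simp: s_def abs_mult powr_powr right_diff_distrib abs_sgn_eq)
      moreover have "\<bar>w' x\<bar> = (\<bar>w' x\<bar> powr p) powr (1 / p)"
        using p by (simp add: powr_powr)
      moreover note bound[OF True]
      ultimately have "p * (\<bar>s x\<bar> * \<bar>w' x\<bar> * \<bar>\<phi> x\<bar>) \<le> p * ((\<bar>w x\<bar> powr p) powr (1 - 1 / p) *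
          (\<bar>w' x\<bar> powr p) powr (1 / p) * (c * \<phi>' x powr (1 - 1 / p)))"
        using p by (intro mult_left_mono mult_mono) auto
      also have "\<dots> = p * c * (Q x powr (1 - 1 / p) * (\<bar>w' x\<bar> powr p) powr (1 / p))"
        using \<phi>'0[OF True] by (simp add: Q_def powr_mult mult_ac)
      finally have "\<bar>P x\<bar> \<le> \<dots>" using p by (simp add: P_def abs_mult mult_ac)
      then show ?thesis by linarith
    next
      case False
      then have "x \<notin> K" using U by auto
      then show ?thesis using zero by simp
    qed
  qed (use intP in auto)
  also have "\<dots> \<le> p * c * ((LINT x|lborel. Q x) powr (1 - 1 / p) * (LINT x|lborel. \<bar>w' x\<bar> powr p) powr (1 / p))"
    using p c intQ intw' Qnn by (subst integral_mult_right_zero, intro mult_left_mono Holder_integral) auto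
  \<comment> \<open>The integral of Q reappears on the right to the power 1 - 1/p and is
    absorbed.\<close>
  finally have "(LINT x|lborel. Q x) \<le> (p * c) powr p * (LINT x|lborel. \<bar>w' x\<bar> powr p)"
    using p c Qnn by (intro le_if_le_Holder) auto
  then show "(LINT x|lborel. \<bar>w x\<bar> powr p * \<phi>' x) \<le> (p * c) powr p * (LINT x|lborel. \<bar>w' x\<bar> powr p)"
    by (simp add: Q_def)
  show "integrable lborel (\<lambda>x. \<bar>w x\<bar> powr p * \<phi>' x)"
    using intQ by (simp add: Q_def)
qed

section \<open>Hardy's inequality on Lipschitz domains\<close>

text \<open>Functions of compact support in \<open>\<Omega>\<close>, extended by zero and paired
  with their gradient \<open>G\<close>, so that integrals over \<open>\<Omega>\<close> become
  integrals over the whole space.\<close>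

definition C1_compact_support :: "'a::euclidean_space set \<Rightarrow> ('a \<Rightarrow> real) \<Rightarrow> ('a \<Rightarrow> 'a) \<Rightarrow> bool" where
  "C1_compact_support \<Omega> u G \<longleftrightarrow> continuous_on UNIV G \<and> (\<forall>x. (u has_derivative (\<lambda>h. G x \<bullet> h)) (at x)) \<and>
     (\<exists>K. compact K \<and> K \<subseteq> \<Omega> \<and> (\<forall>x. x \<notin> K \<longrightarrow> u x = 0 \<and> G x = 0))"

lemma C1_compact_supportD:
  assumes "C1_compact_support \<Omega> u G"
  shows "continuous_on UNIV u" "continuous_on UNIV G" "\<And>x. (u has_derivative (\<lambda>h. G x \<bullet> h)) (at x)"
    "\<And>x. x \<notin> \<Omega> \<Longrightarrow> u x = 0" "\<And>x. x \<notin> \<Omega> \<Longrightarrow> G x = 0"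
proof -
  show "(u has_derivative (\<lambda>h. G x \<bullet> h)) (at x)" for x
    using assms by (simp add: C1_compact_support_def)
  then show "continuous_on UNIV u"
    by (intro continuous_at_imp_continuous_on) (auto intro: has_derivative_continuous)
qed (use assms in \<open>auto simp: C1_compact_support_def\<close>)

lemma C1_compact_support_dir_deriv:
  assumes "C1_compact_support \<Omega> u G"
  shows "has_dir_deriv u e (G x \<bullet> e) x"
proof -
  have "((\<lambda>\<tau>. x + \<tau> *\<^sub>R e) has_derivative (\<lambda>\<tau>. \<tau> *\<^sub>R e)) (at 0)"
    by (auto intro!: derivative_eq_intros)
  moreover have "(u has_derivative (\<lambda>h. G x \<bullet> h)) (at (x + 0 *\<^sub>R e))"
    using C1_compact_supportD(3)[OF assms] by simp
  ultimately have "((\<lambda>\<tau>. u (x + \<tau> *\<^sub>R e)) has_derivative (\<lambda>\<tau>. G x \<bullet> (\<tau> *\<^sub>R e))) (at 0)"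
    by (rule has_derivative_compose)
  then show ?thesis
    by (simp add: has_dir_deriv_def has_field_derivative_def mult_commute_abs)
qed

lemma integrable_norm_gradient:
  assumes "C1_compact_support \<Omega> u G" "p > 0"
  shows "integrable lborel (\<lambda>x. norm (G x) powr p)"
    and "integrable lborel (\<lambda>x. \<bar>G x \<bullet> e\<bar> powr p)"
    and "integrable lborel (\<lambda>x. \<bar>u x\<bar> powr p)"
proof -
  obtain K where K: "compact K" "K \<subseteq> \<Omega>" "\<And>x. x \<notin> K \<Longrightarrow> u x = 0" "\<And>x. x \<notin> K \<Longrightarrow> G x = 0"
    using assms(1) unfolding C1_compact_support_def by blast
  note c = C1_compact_supportD(1,2)[OF assms(1)]
  show "integrable lborel (\<lambda>x. norm (G x) powr p)"
    using assms K c by (intro integrable_continuous_compact_support[OF _ K(1)] continuous_on_powr')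
      (auto intro!: continuous_intros)
  show "integrable lborel (\<lambda>x. \<bar>G x \<bullet> e\<bar> powr p)"
    using assms K c by (intro integrable_continuous_compact_support[OF _ K(1)] continuous_on_powr')
      (auto intro!: continuous_intros)
  show "integrable lborel (\<lambda>x. \<bar>u x\<bar> powr p)"
    using assms K c by (intro integrable_continuous_compact_support[OF _ K(1)] continuous_on_powr')
      (auto intro!: continuous_intros)
qed

text \<open>\<open>weighted_Hardy\<close> with \<phi>(x) = x . e for a unit vector e: its derivative
  along e is 1, and it is bounded by R on a ball of radius R around 0 that contains
  \<open>\<Omega>\<close>.\<close>

lemma Poincare:
  fixes \<Omega> :: "'a::euclidean_space set"
  assumes "bounded \<Omega>" "p > 1"
  shows "\<exists>C\<ge>0. \<forall>u G. C1_compact_support \<Omega> u G \<longrightarrow>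
    (LINT x|lborel. \<bar>u x\<bar> powr p) \<le> C * (LINT x|lborel. norm (G x) powr p)"
proof -
  obtain R where R: "R > 0" "\<Omega> \<subseteq> ball 0 R"
    using bounded_subset_ballD[OF assms(1), of 0] by blast
  obtain e :: 'a where e: "norm e = 1" using vector_choose_size[of 1] by auto
  have "(LINT x|lborel. \<bar>u x\<bar> powr p) \<le> (p * R) powr p * (LINT x|lborel. norm (G x) powr p)"
    if u: "C1_compact_support \<Omega> u G" for u G
  proof -
    obtain K where K: "compact K" "K \<subseteq> \<Omega>" "\<And>x. x \<notin> K \<Longrightarrow> u x = 0" "\<And>x. x \<notin> K \<Longrightarrow> G x = 0"
      using u unfolding C1_compact_support_def by blast
    note c = C1_compact_supportD(1,2)[OF u]
    have le: "\<bar>x \<bullet> e\<bar> \<le> norm x" for x using Cauchy_Schwarz_ineq2[of x e] e by simp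
    have "(LINT x|lborel. \<bar>u x\<bar> powr p * 1) \<le> (p * R) powr p * (LINT x|lborel. \<bar>G x \<bullet> e\<bar> powr p)"
    proof (rule weighted_Hardy(2)[where U = "ball 0 R" and K = K and \<phi> = "\<lambda>x. x \<bullet> e" and e = e])
      show "has_dir_deriv (\<lambda>x. x \<bullet> e) e 1 x" for x
        unfolding has_dir_deriv_def inner_add_left
        using e by (auto intro!: derivative_eq_intros simp: dot_square_norm)
      show "\<bar>x \<bullet> e\<bar> \<le> R * 1 powr (1 - 1 / p)" if "x \<in> ball 0 R" for x
        using le[of x] that by simp
    qed (use assms K R c in \<open>auto intro!: continuous_intros C1_compact_support_dir_deriv[OF u]\<close>)
    also have "\<dots> \<le> (p * R) powr p * (LINT x|lborel. norm (G x) powr p)"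
      using assms le Cauchy_Schwarz_ineq2[of _ e] e
      by (intro mult_left_mono integral_mono integrable_norm_gradient[OF u] powr_mono2) force+
    finally show ?thesis by simp
  qed
  then show ?thesis by (intro exI[of _ "(p * R) powr p"]) auto
qed

section \<open>Powers of the boundary distance, and cutoff functions\<close>

lemma bdist_pos:
  fixes \<Omega> :: "'a::euclidean_space set"
  assumes "open \<Omega>" "bounded \<Omega>" "x \<in> \<Omega>"
  shows "bdist \<Omega> x > 0"
proof -
  have "frontier \<Omega> \<noteq> {}" using assms by (auto simp: frontier_eq_empty)
  moreover have "x \<notin> frontier \<Omega>" using assms by (auto simp: frontier_def interior_open)
  ultimately show ?thesis unfolding bdist_def
    by (intro infdist_pos_not_in_closed) auto
qed

lemma bdist_attained:
  fixes \<Omega> :: "'a::euclidean_space set"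
  assumes "bounded \<Omega>" "\<Omega> \<noteq> {}"
  obtains z where "z \<in> frontier \<Omega>" "bdist \<Omega> x = dist x z"
proof -
  have "frontier \<Omega> \<noteq> {}" using assms by (auto simp: frontier_eq_empty)
  then show ?thesis using infdist_attains_inf[of "frontier \<Omega>" x] that by (auto simp: bdist_def)
qed

lemma continuous_on_bdist_powr:
  assumes "open \<Omega>" "bounded \<Omega>"
  shows "continuous_on \<Omega> (\<lambda>x. bdist \<Omega> x powr a)"
proof -
  have "continuous_on \<Omega> (bdist \<Omega>)" unfolding bdist_def by (intro continuous_intros)
  then show ?thesis using bdist_pos[OF assms] by (intro continuous_on_powr continuous_on_const) force+
qed

text \<open>For either sign of \<open>a\<close>: the weight is continuous inside
  \<open>\<Omega>\<close>, and any singularity at the boundary stays away from the compact support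
  of \<open>u\<close>.\<close>

lemma weighted_powr_compact_support:
  assumes "open \<Omega>" "bounded \<Omega>" "C1_compact_support \<Omega> u G" "q > 0"
  shows "continuous_on UNIV (\<lambda>x. bdist \<Omega> x powr a * \<bar>u x\<bar> powr q)"
    and "integrable lborel (\<lambda>x. bdist \<Omega> x powr a * \<bar>u x\<bar> powr q)"
proof -
  obtain K where K: "compact K" "K \<subseteq> \<Omega>" "\<And>x. x \<notin> K \<Longrightarrow> u x = 0" "\<And>x. x \<notin> K \<Longrightarrow> G x = 0"
    using assms(3) unfolding C1_compact_support_def by blast
  have "continuous_on UNIV (\<lambda>x. \<bar>u x\<bar> powr q)"
    using C1_compact_supportD(1)[OF assms(3)] assms(4)
    by (intro continuous_on_powr') (auto intro!: continuous_intros)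
  then show "continuous_on UNIV (\<lambda>x. bdist \<Omega> x powr a * \<bar>u x\<bar> powr q)"
    using K assms(1,2)
    by (intro continuous_on_UNIV_extend_zero[of \<Omega> K] continuous_on_mult continuous_on_bdist_powr)
       (auto intro: compact_imp_closed continuous_on_subset)
  then show "integrable lborel (\<lambda>x. bdist \<Omega> x powr a * \<bar>u x\<bar> powr q)"
    using K by (intro integrable_continuous_compact_support[OF _ K(1)]) auto
qed

lemma powr_add_le:
  fixes a b :: real
  assumes "a \<ge> 0" "b \<ge> 0" "p \<ge> 0"
  shows "(a + b) powr p \<le> 2 powr p * (a powr p + b powr p)"
proof -
  have "(a + b) powr p \<le> (2 * max a b) powr p" using assms by (intro powr_mono2) auto
  also have "\<dots> = 2 powr p * max a b powr p" using assms by (simp add: powr_mult)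
  also have "\<dots> \<le> 2 powr p * (a powr p + b powr p)"
    by (intro mult_left_mono) (auto simp: max_def)
  finally show ?thesis .
qed

lemma DERIV_max_0_square:
  "((\<lambda>s::real. (max 0 s)\<^sup>2) has_real_derivative 2 * max 0 s) (at s)"
proof -
  consider "s > 0" | "s < 0" | "s = 0" by linarith
  then show ?thesis
  proof cases
    case 1
    have "((\<lambda>s. s\<^sup>2) has_real_derivative 2 * max 0 s) (at s)"
      using 1 by (auto intro!: derivative_eq_intros)
    then show ?thesis
      by (rule has_field_derivative_transform_within_open[where S = "{0<..}"]) (use 1 in auto)
  next
    case 2
    have "((\<lambda>s. 0) has_real_derivative 2 * max 0 s) (at s)" using 2 by simp
    then show ?thesis
      by (rule has_field_derivative_transform_within_open[where S = "{..<0}"]) (use 2 in auto)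
  next
    case 3
    have "((\<lambda>h::real. max 0 h) \<longlongrightarrow> max 0 0) (at 0)" by (intro tendsto_intros)
    moreover have "\<forall>\<^sub>F h in at (0::real). max 0 h = (max 0 h)\<^sup>2 / h"
      by (auto simp: eventually_at_filter max_def power2_eq_square)
    ultimately have "((\<lambda>h::real. (max 0 h)\<^sup>2 / h) \<longlongrightarrow> max 0 0) (at 0)"
      by (rule Lim_transform_eventually)
    then show ?thesis using 3 by (simp add: has_field_derivative_iff)
  qed
qed

text \<open>The witness is the square of the positive part of 1 - |x - x0|^2 / \<rho>^2. Squaring
  makes the derivative continuous across the sphere; on the half ball the value is at least
  (3/4)^2.\<close>

lemma exists_cutoff:
  fixes x0 e :: "'a::euclidean_space"
  assumes "\<rho> > 0" "norm e = 1"
  shows "\<exists>\<zeta> \<zeta>'. continuous_on UNIV \<zeta> \<and> continuous_on UNIV \<zeta>' \<and> (\<forall>x. has_dir_deriv \<zeta> e (\<zeta>' x) x) \<and>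
    (\<forall>x. x \<notin> cball x0 \<rho> \<longrightarrow> \<zeta> x = 0) \<and> (\<forall>x. x \<notin> cball x0 \<rho> \<longrightarrow> \<zeta>' x = 0) \<and>
    (\<forall>x. \<bar>\<zeta> x\<bar> \<le> 1) \<and> (\<forall>x. \<bar>\<zeta>' x\<bar> \<le> 4 / \<rho>) \<and> (\<forall>x\<in>ball x0 (\<rho> / 2). \<zeta> x \<ge> (1 / 2 :: real))"
proof -
  define s where "s = (\<lambda>x. 1 - ((x - x0) \<bullet> (x - x0)) / \<rho>\<^sup>2)"
  define \<zeta> where "\<zeta> = (\<lambda>x. (max 0 (s x))\<^sup>2)"
  define \<zeta>' where "\<zeta>' = (\<lambda>x. 2 * max 0 (s x) * (- 2 * ((x - x0) \<bullet> e) / \<rho>\<^sup>2))"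
  have s1: "s x \<le> 1" for x by (simp add: s_def)
  have s0: "s x \<le> 0" if "x \<notin> cball x0 \<rho>" for x
  proof -
    have "\<rho> ^ 2 \<le> norm (x - x0) ^ 2"
      using that assms by (intro power_mono) (auto simp: dist_norm norm_minus_commute)
    then show ?thesis using assms by (simp add: s_def power2_norm_eq_inner)
  qed
  show ?thesis
  proof (rule exI[of _ \<zeta>], rule exI[of _ \<zeta>'], intro conjI allI impI ballI)
    show "continuous_on UNIV \<zeta>" "continuous_on UNIV \<zeta>'"
      unfolding \<zeta>_def \<zeta>'_def s_def using assms by (auto intro!: continuous_intros)
    show "has_dir_deriv \<zeta> e (\<zeta>' x) x" for x
    proof -
      have "((\<lambda>\<tau>. s (x + \<tau> *\<^sub>R e)) has_real_derivative (- 2 * ((x - x0) \<bullet> e) / \<rho>\<^sup>2)) (at 0)"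
      proof -
        have "s (x + \<tau> *\<^sub>R e) = s x - (2 * \<tau> * ((x - x0) \<bullet> e) + \<tau>\<^sup>2) / \<rho>\<^sup>2" for \<tau>
        proof -
          have "(x + \<tau> *\<^sub>R e - x0) \<bullet> (x + \<tau> *\<^sub>R e - x0) = (x - x0) \<bullet> (x - x0) + (2 * \<tau> * ((x - x0) \<bullet> e) + \<tau>\<^sup>2 * (e \<bullet> e))"
            by (simp add: algebra_simps inner_commute power2_eq_square)
          then show ?thesis using assms by (simp add: s_def dot_square_norm add_divide_distrib)
        qed
        then show ?thesis
          using assms by (auto intro!: derivative_eq_intros simp: power2_eq_square power4_eq_xxxx)
      qed
      from DERIV_chain2[OF DERIV_max_0_square this] show ?thesis
        by (simp add: has_dir_deriv_def \<zeta>_def \<zeta>'_def)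
    qed
    show "\<zeta> x = 0" "\<zeta>' x = 0" if "x \<notin> cball x0 \<rho>" for x
      using s0[OF that] by (auto simp: \<zeta>_def \<zeta>'_def max_def)
    show "\<bar>\<zeta> x\<bar> \<le> 1" for x
      using s1[of x] by (simp add: \<zeta>_def power_le_one)
    show "\<bar>\<zeta>' x\<bar> \<le> 4 / \<rho>" for x
    proof (cases "x \<in> cball x0 \<rho>")
      case False
      then show ?thesis using s0[OF False] assms by (simp add: \<zeta>'_def max_def)
    next
      case True
      have "\<bar>(x - x0) \<bullet> e\<bar> \<le> \<rho>"
        using True Cauchy_Schwarz_ineq2[of "x - x0" e] assms by (simp add: dist_norm norm_minus_commute)
      then have "\<bar>2 * max 0 (s x)\<bar> * \<bar>- 2 * ((x - x0) \<bullet> e) / \<rho>\<^sup>2\<bar> \<le> 2 * (2 * \<rho> / \<rho>\<^sup>2)"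
        using s1[of x] assms by (intro mult_mono) (auto simp: abs_mult divide_right_mono)
      then show ?thesis using assms by (simp add: \<zeta>'_def abs_mult power2_eq_square)
    qed
    show "\<zeta> x \<ge> 1 / 2" if "x \<in> ball x0 (\<rho> / 2)" for x
    proof -
      have "norm (x - x0) ^ 2 \<le> (\<rho> / 2) ^ 2"
        using that assms by (intro power_mono) (auto simp: dist_norm norm_minus_commute)
      then have "s x \<ge> 3 / 4" using assms by (simp add: s_def power2_norm_eq_inner field_simps)
      then have "(3 / 4)\<^sup>2 \<le> \<zeta> x" unfolding \<zeta>_def by (intro power_mono) auto
      then show ?thesis by (simp add: power2_eq_square)
    qed
  qed
qed

text \<open>\<open>weighted_Hardy\<close> is applied to \<zeta> u with \<phi> = - t^(1-p) / (p - 1),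
  whose derivative along e is t^(-p) and for which |\<phi>| = \<phi>'^(1-1/p) / (p - 1). The term
  with the derivative of \<zeta> is controlled by Poincare's inequality.\<close>

lemma Hardy_near_boundary_point:
  fixes \<Omega> :: "'a::euclidean_space set"
  assumes \<Omega>: "open \<Omega>" "bounded \<Omega>" "lipschitz_boundary \<Omega>" and p: "p > 1" and x0: "x0 \<in> frontier \<Omega>"
  shows "\<exists>\<rho>>0. \<exists>C\<ge>0. \<forall>u G. C1_compact_support \<Omega> u G \<longrightarrow>
    (LINT x|lborel. indicator (ball x0 \<rho>) x * (bdist \<Omega> x powr (- p) * \<bar>u x\<bar> powr p))
      \<le> C * (LINT x|lborel. norm (G x) powr p)"
proof -
  obtain r e g L where r: "r > 0" and e: "norm e = 1" and g: "L-lipschitz_on {z. z \<bullet> e = 0} g"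
    and graph: "\<Omega> \<inter> ball x0 r = {y \<in> ball x0 r. g (y - (y \<bullet> e) *\<^sub>R e) < y \<bullet> e}"
    using bspec[OF \<Omega>(3)[unfolded lipschitz_boundary_def] x0] by blast
  have ee: "e \<bullet> e = 1" using e by (simp add: dot_square_norm)
  have L: "L \<ge> 0" using g by (rule lipschitz_on_nonneg)
  define pr where "pr = (\<lambda>y. y - (y \<bullet> e) *\<^sub>R e)"
  have pr: "pr y \<in> {z. z \<bullet> e = 0}" for y using ee by (simp add: pr_def inner_diff_left)
  have pr_line: "pr (y + \<tau> *\<^sub>R e) = pr y" for y \<tau>
    by (simp add: pr_def algebra_simps ee)
  define t where "t = (\<lambda>y. y \<bullet> e - g (pr y))"
  \<comment> \<open>Half the radius: the frontier point nearest to a point y of \<open>U\<close> is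
    at distance at most dist y x0 < r/2, hence still lies in the ball where the graph describes
    \<open>\<Omega>\<close>.\<close>
  define U where "U = \<Omega> \<inter> ball x0 (r / 2)"
  have tpos: "t y > 0" if "y \<in> U" for y
  proof -
    have "y \<in> \<Omega> \<inter> ball x0 r" using that r by (auto simp: U_def)
    then show ?thesis using graph by (auto simp: t_def pr_def)
  qed
  \<comment> \<open>The nearest frontier point z has height at most 0, so t y \<le> (y - z) . e + g
    (pr z) - g (pr y). The triangle inequality gives \<open>pr\<close> the Lipschitz constant 2,
    whence 2 L.\<close>
  have t_le: "t y \<le> (1 + 2 * L) * bdist \<Omega> y" if y: "y \<in> U" for y
  proof -
    have "\<Omega> \<noteq> {}" using y by (auto simp: U_def)
    then obtain z where z: "z \<in> frontier \<Omega>" "bdist \<Omega> y = dist y z"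
      using bdist_attained[OF \<Omega>(2)] by metis
    have "dist y z \<le> dist y x0" using x0 unfolding z(2)[symmetric] bdist_def by (rule infdist_le)
    then have "z \<in> ball x0 r"
      using y dist_triangle[of x0 z y] by (auto simp: U_def dist_commute)
    moreover have "z \<notin> \<Omega>" using z(1) \<Omega>(1) by (auto simp: frontier_def interior_open)
    ultimately have "z \<bullet> e \<le> g (pr z)" using graph by (force simp: pr_def)
    moreover have "\<bar>(y - z) \<bullet> e\<bar> \<le> dist y z"
      using Cauchy_Schwarz_ineq2[of "y - z" e] e by (simp add: dist_norm)
    moreover have "\<bar>g (pr z) - g (pr y)\<bar> \<le> L * (2 * dist y z)"
    proof -
      have "dist (g (pr z)) (g (pr y)) \<le> L * dist (pr z) (pr y)"
        by (rule lipschitz_onD[OF g pr pr])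
      moreover have "dist (pr z) (pr y) \<le> 2 * dist y z"
      proof -
        have "pr z - pr y = - ((y - z) - ((y - z) \<bullet> e) *\<^sub>R e)" by (simp add: pr_def algebra_simps)
        then have "dist (pr z) (pr y) \<le> norm (y - z) + norm (((y - z) \<bullet> e) *\<^sub>R e)"
          unfolding dist_norm using norm_triangle_ineq4 by (metis norm_minus_cancel)
        then show ?thesis using \<open>\<bar>(y - z) \<bullet> e\<bar> \<le> dist y z\<close> e by (simp add: dist_norm)
      qed
      ultimately show ?thesis
        using mult_left_mono[OF _ L] by (fastforce simp: dist_real_def)
    qed
    ultimately show ?thesis by (simp add: t_def z(2) inner_diff_left algebra_simps abs_le_iff)
  qed
  have t_cont: "continuous_on UNIV t"
  proof -
    have "continuous_on {z. z \<bullet> e = 0} g" using g by (rule lipschitz_on_continuous_on)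
    then have "continuous_on UNIV (\<lambda>y. g (pr y))"
      by (rule continuous_on_compose2) (use pr in \<open>auto simp: pr_def intro!: continuous_intros\<close>)
    then show ?thesis unfolding t_def by (intro continuous_intros)
  qed
  have t_powr: "continuous_on U (\<lambda>y. t y powr a)" for a
    using t_cont tpos by (intro continuous_on_powr continuous_on_const) (force intro: continuous_on_subset)+
  define \<rho> where "\<rho> = r / 3"
  have \<rho>: "\<rho> > 0" "cball x0 \<rho> \<subseteq> ball x0 (r / 2)" using r by (auto simp: \<rho>_def)
  obtain \<zeta> \<zeta>' :: "'a \<Rightarrow> real" where \<zeta>: "continuous_on UNIV \<zeta>" "continuous_on UNIV \<zeta>'"
    "\<And>x. has_dir_deriv \<zeta> e (\<zeta>' x) x" "\<And>x. x \<notin> cball x0 \<rho> \<Longrightarrow> \<zeta> x = 0" "\<And>x. x \<notin> cball x0 \<rho> \<Longrightarrow> \<zeta>' x = 0"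
    "\<And>x. \<bar>\<zeta> x\<bar> \<le> 1" "\<And>x. \<bar>\<zeta>' x\<bar> \<le> 4 / \<rho>" "\<And>x. x \<in> ball x0 (\<rho> / 2) \<Longrightarrow> \<zeta> x \<ge> 1 / 2"
    using exists_cutoff[OF \<rho>(1) e, of x0] by blast
  obtain CP where CP: "CP \<ge> 0" "\<And>u G. C1_compact_support \<Omega> u G \<Longrightarrow>
      (LINT x|lborel. \<bar>u x\<bar> powr p) \<le> CP * (LINT x|lborel. norm (G x) powr p)"
    using Poincare[OF \<Omega>(2) p] by blast
  \<comment> \<open>The factors of \<open>c\<close> come from \<delta>^(-p) \<le> (1 + 2 L)^p t^(-p)
    and from |u| \<le> 2 |\<zeta> u| on the smaller ball; \<open>C\<close> multiplies in the Hardy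
    constant and the bound for the derivative of \<zeta> u.\<close>
  define c where "c = (1 + 2 * L) powr p * 2 powr p"
  define C where "C = c * ((p * (1 / (p - 1))) powr p * (2 powr p * ((4 / \<rho>) powr p * CP + 1)))"
  have "(LINT x|lborel. indicator (ball x0 (\<rho> / 2)) x * (bdist \<Omega> x powr (- p) * \<bar>u x\<bar> powr p))
      \<le> C * (LINT x|lborel. norm (G x) powr p)" if u: "C1_compact_support \<Omega> u G" for u G
  proof -
    obtain K where K: "compact K" "K \<subseteq> \<Omega>" "\<And>x. x \<notin> K \<Longrightarrow> u x = 0" "\<And>x. x \<notin> K \<Longrightarrow> G x = 0"
      using u unfolding C1_compact_support_def by blast
    note cont = C1_compact_supportD(1,2)[OF u]
    define K' where "K' = K \<inter> cball x0 \<rho>"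
    have K': "compact K'" "K' \<subseteq> U" using K \<rho> by (auto simp: K'_def U_def intro!: compact_Int_closed)
    define w where "w = (\<lambda>x. \<zeta> x * u x)"
    define w' where "w' = (\<lambda>x. \<zeta>' x * u x + (G x \<bullet> e) * \<zeta> x)"
    have w: "continuous_on UNIV w" "continuous_on UNIV w'"
      unfolding w_def w'_def using cont \<zeta> by (auto intro!: continuous_intros)
    have w0: "w x = 0" "w' x = 0" if "x \<notin> K'" for x
      using that K \<zeta>(4,5)[of x] by (auto simp: K'_def w_def w'_def)
    have dw: "has_dir_deriv w e (w' x) x" for x
      using DERIV_mult[OF \<zeta>(3)[of x, unfolded has_dir_deriv_def]
          C1_compact_support_dir_deriv[OF u, of e x, unfolded has_dir_deriv_def]]
      by (simp add: has_dir_deriv_def w_def w'_def)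
    have dt: "has_dir_deriv (\<lambda>y. - (t y powr (1 - p)) / (p - 1)) e (t y powr (- p)) y" if "y \<in> U" for y
    proof -
      have "t (y + \<tau> *\<^sub>R e) = t y + \<tau>" for \<tau>
        by (simp add: t_def pr_line inner_add_left ee)
      moreover have "((\<lambda>\<tau>. - ((t y + \<tau>) powr (1 - p)) / (p - 1)) has_real_derivative t y powr (- p)) (at 0)"
        using tpos[OF that] p by (auto intro!: derivative_eq_intros simp: divide_simps) (simp add: algebra_simps)
      ultimately show ?thesis by (simp add: has_dir_deriv_def)
    qed
    have bound: "\<bar>- (t y powr (1 - p)) / (p - 1)\<bar> \<le> 1 / (p - 1) * (t y powr (- p)) powr (1 - 1 / p)"
      if "y \<in> U" for y
    proof -
      have "- p * (1 - 1 / p) = 1 - p" using p by (simp add: field_simps)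
      then show ?thesis using p by (simp add: powr_powr)
    qed
    note H = weighted_Hardy[where \<phi> = "\<lambda>y. - (t y powr (1 - p)) / (p - 1)" and \<phi>' = "\<lambda>y. t y powr (- p)"
        and U = U and K = K' and c = "1 / (p - 1)", OF p w dw K'(1) w0 _ K'(2) _ _ dt _ bound]
    have prem: "open U" "continuous_on U (\<lambda>y. - (t y powr (1 - p)) / (p - 1))" "continuous_on U (\<lambda>y. t y powr (- p))"
      "\<And>x. x \<in> U \<Longrightarrow> t x powr (- p) \<ge> 0" "1 / (p - 1) \<ge> 0"
      using p t_powr \<Omega>(1) by (auto simp: U_def intro!: continuous_on_divide continuous_on_minus continuous_on_const)
    have intw: "integrable lborel (\<lambda>x. \<bar>w x\<bar> powr p * t x powr (- p))"
      using prem by (intro H(1)) auto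
    have Hw: "(LINT x|lborel. \<bar>w x\<bar> powr p * t x powr (- p))
        \<le> (p * (1 / (p - 1))) powr p * (LINT x|lborel. \<bar>w' x\<bar> powr p)"
      using prem by (intro H(2)) auto
    have "\<bar>w' x\<bar> powr p \<le> 2 powr p * ((4 / \<rho>) powr p * \<bar>u x\<bar> powr p + norm (G x) powr p)" for x
    proof -
      have "\<bar>w' x\<bar> \<le> \<bar>\<zeta>' x\<bar> * \<bar>u x\<bar> + \<bar>G x \<bullet> e\<bar> * \<bar>\<zeta> x\<bar>"
        unfolding w'_def by (metis abs_mult abs_triangle_ineq)
      also have "\<dots> \<le> 4 / \<rho> * \<bar>u x\<bar> + norm (G x) * 1"
        using \<zeta>(6,7)[of x] Cauchy_Schwarz_ineq2[of "G x" e] e \<rho>(1) by (intro add_mono mult_mono) auto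
      finally have "\<bar>w' x\<bar> powr p \<le> (4 / \<rho> * \<bar>u x\<bar> + norm (G x)) powr p"
        using p by (intro powr_mono2) auto
      also have "\<dots> \<le> 2 powr p * ((4 / \<rho> * \<bar>u x\<bar>) powr p + norm (G x) powr p)"
        using p \<rho> by (intro powr_add_le) auto
      finally show ?thesis using \<rho> by (simp only: powr_mult)
    qed
    then have "(LINT x|lborel. \<bar>w' x\<bar> powr p)
        \<le> (LINT x|lborel. 2 powr p * ((4 / \<rho>) powr p * \<bar>u x\<bar> powr p + norm (G x) powr p))"
    proof (intro integral_mono)
      show "integrable lborel (\<lambda>x. \<bar>w' x\<bar> powr p)"
        using w w0 K' p by (intro integrable_continuous_compact_support[OF _ K'(1)] continuous_on_powr')
          (auto intro!: continuous_intros)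
    qed (use integrable_norm_gradient[OF u, of p] p in auto)
    also have "\<dots> = 2 powr p * ((4 / \<rho>) powr p * (LINT x|lborel. \<bar>u x\<bar> powr p) + (LINT x|lborel. norm (G x) powr p))"
      using integrable_norm_gradient[OF u, of p] p by simp
    also have "\<dots> \<le> 2 powr p * ((4 / \<rho>) powr p * (CP * (LINT x|lborel. norm (G x) powr p)) + (LINT x|lborel. norm (G x) powr p))"
      by (intro mult_left_mono add_mono CP(2)[OF u]) auto
    finally have w'_le: "(LINT x|lborel. \<bar>w' x\<bar> powr p)
      \<le> 2 powr p * ((4 / \<rho>) powr p * CP + 1) * (LINT x|lborel. norm (G x) powr p)"
      by (simp add: algebra_simps)
    have "(LINT x|lborel. indicator (ball x0 (\<rho> / 2)) x * (bdist \<Omega> x powr (- p) * \<bar>u x\<bar> powr p))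
        \<le> (LINT x|lborel. c * (\<bar>w x\<bar> powr p * t x powr (- p)))"
    proof (intro integral_mono integrable_mult_right intw)
      show "integrable lborel (\<lambda>x. indicator (ball x0 (\<rho> / 2)) x * (bdist \<Omega> x powr (- p) * \<bar>u x\<bar> powr p))"
        using integrable_real_mult_indicator[OF _ weighted_powr_compact_support(2)[OF \<Omega>(1,2) u, of p "- p"],
            of "ball x0 (\<rho> / 2)"] p by (simp add: mult.commute)
      fix x
      show "indicator (ball x0 (\<rho> / 2)) x * (bdist \<Omega> x powr (- p) * \<bar>u x\<bar> powr p)
        \<le> c * (\<bar>w x\<bar> powr p * t x powr (- p))"
      proof (cases "x \<in> \<Omega> \<inter> ball x0 (\<rho> / 2)")
        case False
        then have "indicator (ball x0 (\<rho> / 2)) x * (bdist \<Omega> x powr (- p) * \<bar>u x\<bar> powr p) = 0"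
          using C1_compact_supportD(4)[OF u] by (auto simp: indicator_def)
        moreover have "c * (\<bar>w x\<bar> powr p * t x powr (- p)) \<ge> 0" by (simp add: c_def)
        ultimately show ?thesis by linarith
      next
        case True
        then have x: "x \<in> U" using r by (auto simp: U_def \<rho>_def)
        have "bdist \<Omega> x powr (- p) = (1 + 2 * L) powr p * ((1 + 2 * L) * bdist \<Omega> x) powr (- p)"
          using L bdist_pos[OF \<Omega>(1,2), of x] True by (simp add: powr_mult powr_minus)
        also have "\<dots> \<le> (1 + 2 * L) powr p * t x powr (- p)"
          using tpos[OF x] t_le[OF x] p by (intro mult_left_mono powr_mono2') auto
        finally have 1: "bdist \<Omega> x powr (- p) \<le> (1 + 2 * L) powr p * t x powr (- p)" .
        have "\<bar>u x\<bar> \<le> 2 * \<bar>w x\<bar>"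
          using mult_right_mono[OF \<zeta>(8)[of x], of "\<bar>u x\<bar>"] True \<zeta>(8)[of x] by (simp add: w_def abs_mult)
        then have "\<bar>u x\<bar> powr p \<le> (2 * \<bar>w x\<bar>) powr p" using p by (intro powr_mono2) auto
        then have 2: "\<bar>u x\<bar> powr p \<le> 2 powr p * \<bar>w x\<bar> powr p" by (simp add: powr_mult)
        have "bdist \<Omega> x powr (- p) * \<bar>u x\<bar> powr p \<le> ((1 + 2 * L) powr p * t x powr (- p)) * (2 powr p * \<bar>w x\<bar> powr p)"
          using 1 2 by (intro mult_mono) auto
        then show ?thesis using True by (simp add: c_def mult_ac)
      qed
    qed
    also have "\<dots> = c * (LINT x|lborel. \<bar>w x\<bar> powr p * t x powr (- p))" by simp
    also have "\<dots> \<le> c * ((p * (1 / (p - 1))) powr p *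
        (2 powr p * ((4 / \<rho>) powr p * CP + 1) * (LINT x|lborel. norm (G x) powr p)))"
      using order_trans[OF Hw mult_left_mono[OF w'_le]] by (intro mult_left_mono) (auto simp: c_def)
    also have "\<dots> = C * (LINT x|lborel. norm (G x) powr p)" by (simp add: C_def)
    finally show ?thesis .
  qed
  moreover have "C \<ge> 0" using CP by (simp add: C_def c_def)
  ultimately show ?thesis using \<rho> by (intro exI[of _ "\<rho> / 2"]) auto
qed

theorem Hardy:
  fixes \<Omega> :: "'a::euclidean_space set"
  assumes \<Omega>: "open \<Omega>" "bounded \<Omega>" "lipschitz_boundary \<Omega>" "\<Omega> \<noteq> {}" and p: "p > 1"
  shows "\<exists>C\<ge>0. \<forall>u G. C1_compact_support \<Omega> u G \<longrightarrow>
    (LINT x|lborel. bdist \<Omega> x powr (- p) * \<bar>u x\<bar> powr p) \<le> C * (LINT x|lborel. norm (G x) powr p)"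
proof -
  define P where "P = (\<lambda>z \<rho> C. \<rho> > 0 \<and> C \<ge> 0 \<and> (\<forall>u G. C1_compact_support \<Omega> u G \<longrightarrow>
    (LINT x|lborel. indicator (ball z \<rho>) x * (bdist \<Omega> x powr (- p) * \<bar>u x\<bar> powr p))
      \<le> C * (LINT x|lborel. norm (G x) powr p)))"
  have "\<forall>z\<in>frontier \<Omega>. \<exists>\<rho> C. P z \<rho> C"
    using Hardy_near_boundary_point[OF \<Omega>(1-3) p] unfolding P_def by blast
  then obtain \<rho> Cb where P: "\<And>z. z \<in> frontier \<Omega> \<Longrightarrow> P z (\<rho> z) (Cb z)" by metis
  have \<rho>: "\<rho> z > 0" and Cb: "Cb z \<ge> 0" "C1_compact_support \<Omega> u G \<Longrightarrow>
      (LINT x|lborel. indicator (ball z (\<rho> z)) x * (bdist \<Omega> x powr (- p) * \<bar>u x\<bar> powr p))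
      \<le> Cb z * (LINT x|lborel. norm (G x) powr p)" if "z \<in> frontier \<Omega>" for z u G
    using P[OF that] unfolding P_def by blast+
  have "compact (frontier \<Omega>)" using \<Omega>(2) by (rule compact_frontier_bounded)
  then obtain T where T: "T \<subseteq> frontier \<Omega>" "finite T" "frontier \<Omega> \<subseteq> (\<Union>z\<in>T. ball z (\<rho> z))"
    by (rule compactE_image[where C = "frontier \<Omega>" and f = "\<lambda>z. ball z (\<rho> z)"]) (use \<rho> in force)+
  \<comment> \<open>What the finitely many balls miss is compact and disjoint from the frontier,
    hence at distance at least some d > 0 from it. There the weight is at most d^(-p) and Poincare's
    inequality suffices.\<close>
  define S where "S = closure \<Omega> - (\<Union>z\<in>T. ball z (\<rho> z))"
  have "compact S" unfolding S_def using \<Omega>(2) by (intro compact_diff) (auto simp: compact_closure)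
  moreover have "S \<inter> frontier \<Omega> = {}" using T(3) by (auto simp: S_def)
  ultimately obtain d where d: "d > 0" "\<And>x y. x \<in> S \<Longrightarrow> y \<in> frontier \<Omega> \<Longrightarrow> d \<le> dist x y"
    using separate_compact_closed[of S "frontier \<Omega>"] by auto
  obtain CP where CP: "CP \<ge> 0" "\<And>u G. C1_compact_support \<Omega> u G \<Longrightarrow>
      (LINT x|lborel. \<bar>u x\<bar> powr p) \<le> CP * (LINT x|lborel. norm (G x) powr p)"
    using Poincare[OF \<Omega>(2) p] by blast
  have "(LINT x|lborel. bdist \<Omega> x powr (- p) * \<bar>u x\<bar> powr p)
      \<le> ((\<Sum>z\<in>T. Cb z) + d powr (- p) * CP) * (LINT x|lborel. norm (G x) powr p)"
    if u: "C1_compact_support \<Omega> u G" for u G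
  proof -
    define h where "h = (\<lambda>x. bdist \<Omega> x powr (- p) * \<bar>u x\<bar> powr p)"
    have h: "integrable lborel h" "\<And>x. h x \<ge> 0"
      unfolding h_def using weighted_powr_compact_support(2)[OF \<Omega>(1,2) u, of p "- p"] p by auto
    have hi: "integrable lborel (\<lambda>x. indicator (ball z (\<rho> z)) x * h x)" for z
      using integrable_real_mult_indicator[OF _ h(1), of "ball z (\<rho> z)"] by (simp add: mult.commute)
    have "(LINT x|lborel. h x) \<le> (LINT x|lborel. (\<Sum>z\<in>T. indicator (ball z (\<rho> z)) x * h x) + d powr (- p) * \<bar>u x\<bar> powr p)"
    proof (rule integral_mono)
      fix x
      have nn: "0 \<le> (\<Sum>z\<in>T. indicator (ball z (\<rho> z)) x * h x)" using h by (intro sum_nonneg) auto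
      show "h x \<le> (\<Sum>z\<in>T. indicator (ball z (\<rho> z)) x * h x) + d powr (- p) * \<bar>u x\<bar> powr p"
      proof (cases "\<exists>z\<in>T. x \<in> ball z (\<rho> z)")
        case True
        then obtain z where z: "z \<in> T" "x \<in> ball z (\<rho> z)" by blast
        have "h x = indicator (ball z (\<rho> z)) x * h x" using z by simp
        also have "\<dots> \<le> (\<Sum>z\<in>T. indicator (ball z (\<rho> z)) x * h x)"
          using z T h by (intro member_le_sum) auto
        finally show ?thesis by (simp add: add_increasing2)
      next
        case False
        show ?thesis
        proof (cases "x \<in> \<Omega>")
          case True
          then have "x \<in> S" using False closure_subset by (auto simp: S_def)
          obtain z where "z \<in> frontier \<Omega>" "bdist \<Omega> x = dist x z"
            using bdist_attained[OF \<Omega>(2,4)] by metis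
          then have "d \<le> bdist \<Omega> x" using d(2) \<open>x \<in> S\<close> by simp
          then have "bdist \<Omega> x powr (- p) \<le> d powr (- p)" using d p by (intro powr_mono2') auto
          then have "h x \<le> d powr (- p) * \<bar>u x\<bar> powr p" unfolding h_def by (intro mult_right_mono) auto
          then show ?thesis using nn by linarith
        next
          case outside: False
          then have "h x = 0" using C1_compact_supportD(4)[OF u] by (simp add: h_def)
          then show ?thesis using nn by (simp add: add_nonneg_nonneg)
        qed
      qed
    qed (use h hi integrable_norm_gradient[OF u, of p] p in auto)
    also have "\<dots> = (\<Sum>z\<in>T. LINT x|lborel. indicator (ball z (\<rho> z)) x * h x) + d powr (- p) * (LINT x|lborel. \<bar>u x\<bar> powr p)"
      using hi integrable_norm_gradient[OF u, of p] p by simp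
    also have "\<dots> \<le> (\<Sum>z\<in>T. Cb z * (LINT x|lborel. norm (G x) powr p)) + d powr (- p) * (CP * (LINT x|lborel. norm (G x) powr p))"
      using T u by (intro add_mono sum_mono mult_left_mono CP(2)) (auto simp: h_def intro!: Cb)
    also have "\<dots> = ((\<Sum>z\<in>T. Cb z) + d powr (- p) * CP) * (LINT x|lborel. norm (G x) powr p)"
      by (simp add: sum_distrib_right[symmetric] algebra_simps)
    finally show ?thesis by (simp add: h_def)
  qed
  moreover have "(\<Sum>z\<in>T. Cb z) + d powr (- p) * CP \<ge> 0"
    using Cb(1) T CP by (intro add_nonneg_nonneg sum_nonneg) auto
  ultimately show ?thesis by blast
qed

section \<open>Weighted Sobolev inequalities\<close>

lemma slope_le_has_derivative:
  fixes f :: "'a::euclidean_space \<Rightarrow> real"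
  assumes "(f has_derivative (\<lambda>h. g \<bullet> h)) (at x)"
  shows "slope_le f x (norm g)"
  unfolding slope_le_def
proof (intro allI impI)
  fix \<epsilon> :: real assume "\<epsilon> > 0"
  then obtain d where d: "d > 0" "\<And>y. norm (y - x) < d \<Longrightarrow> \<bar>f y - f x - g \<bullet> (y - x)\<bar> \<le> \<epsilon> * norm (y - x)"
    using assms unfolding has_derivative_at_alt by (auto simp del: dist_norm)
  have "\<bar>f y - f x\<bar> \<le> (norm g + \<epsilon>) * dist y x" if "dist y x < d" for y
    using d(2)[of y] that Cauchy_Schwarz_ineq2[of g "y - x"]
    by (simp add: dist_norm algebra_simps abs_le_iff)
  with d(1) show "\<exists>d>0. \<forall>y. dist y x < d \<longrightarrow> \<bar>f y - f x\<bar> \<le> (norm g + \<epsilon>) * dist y x" by blast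
qed

text \<open>A chain rule whose inner function is merely 1-Lipschitz: increments of \<delta> are at
  most dist y x. It serves for powers of the boundary distance.\<close>

lemma slope_le_compose_1_Lipschitz:
  fixes \<phi> :: "real \<Rightarrow> real" and \<delta> :: "'a::euclidean_space \<Rightarrow> real"
  assumes "(\<phi> has_real_derivative m) (at (\<delta> x))" "\<And>y. \<bar>\<delta> y - \<delta> x\<bar> \<le> dist y x"
  shows "slope_le (\<lambda>y. \<phi> (\<delta> y)) x \<bar>m\<bar>"
  unfolding slope_le_def
proof (intro allI impI)
  fix \<epsilon> :: real assume e: "\<epsilon> > 0"
  have "(\<phi> has_derivative (\<lambda>h. m \<bullet> h)) (at (\<delta> x))"
    using assms(1) by (simp add: has_field_derivative_def)
  from slope_le_has_derivative[OF this] e obtain d where d: "d > 0"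
    "\<And>s. dist s (\<delta> x) < d \<Longrightarrow> \<bar>\<phi> s - \<phi> (\<delta> x)\<bar> \<le> (\<bar>m\<bar> + \<epsilon>) * dist s (\<delta> x)"
    unfolding slope_le_def by (metis real_norm_def)
  have "\<bar>\<phi> (\<delta> y) - \<phi> (\<delta> x)\<bar> \<le> (\<bar>m\<bar> + \<epsilon>) * dist y x" if "dist y x < d" for y
  proof -
    have "\<bar>\<phi> (\<delta> y) - \<phi> (\<delta> x)\<bar> \<le> (\<bar>m\<bar> + \<epsilon>) * dist (\<delta> y) (\<delta> x)"
      using assms(2)[of y] that by (intro d) (simp add: dist_real_def)
    also have "\<dots> \<le> (\<bar>m\<bar> + \<epsilon>) * dist y x"
      using assms(2)[of y] e by (intro mult_left_mono) (auto simp: dist_real_def)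
    finally show ?thesis .
  qed
  with d(1) show "\<exists>d>0. \<forall>y. dist y x < d \<longrightarrow> \<bar>\<phi> (\<delta> y) - \<phi> (\<delta> x)\<bar> \<le> (\<bar>m\<bar> + \<epsilon>) * dist y x" by blast
qed

text \<open>Product rule from (f y - f x) h y + f x (h y - h x). Near x the factor |h y| is at most
  |h x| + c, with c so small that all error terms together cost at most \<epsilon>.\<close>

lemma slope_le_mult:
  fixes f h :: "'a::euclidean_space \<Rightarrow> real"
  assumes f: "slope_le f x a" and h: "slope_le h x b" and ab: "a \<ge> 0" "b \<ge> 0"
  shows "slope_le (\<lambda>y. f y * h y) x (a * \<bar>h x\<bar> + \<bar>f x\<bar> * b)"
  unfolding slope_le_def
proof (intro allI impI)
  fix \<epsilon> :: real assume e: "\<epsilon> > 0"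
  have "((\<lambda>c. (a + c) * (\<bar>h x\<bar> + c) + \<bar>f x\<bar> * (b + c)) \<longlongrightarrow> (a + 0) * (\<bar>h x\<bar> + 0) + \<bar>f x\<bar> * (b + 0)) (at_right 0)"
    by (intro tendsto_intros)
  then have "\<forall>\<^sub>F c in at_right 0. (a + c) * (\<bar>h x\<bar> + c) + \<bar>f x\<bar> * (b + c) < a * \<bar>h x\<bar> + \<bar>f x\<bar> * b + \<epsilon>"
    using e by (intro order_tendstoD(2)) auto
  then obtain c where c: "c > 0" "(a + c) * (\<bar>h x\<bar> + c) + \<bar>f x\<bar> * (b + c) < a * \<bar>h x\<bar> + \<bar>f x\<bar> * b + \<epsilon>"
    unfolding eventually_at_right_field by (metis dense)
  obtain d1 where d1: "d1 > 0" "\<And>y. dist y x < d1 \<Longrightarrow> \<bar>f y - f x\<bar> \<le> (a + c) * dist y x"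
    using f c(1) unfolding slope_le_def by blast
  obtain d2 where d2: "d2 > 0" "\<And>y. dist y x < d2 \<Longrightarrow> \<bar>h y - h x\<bar> \<le> (b + c) * dist y x"
    using h c(1) unfolding slope_le_def by blast
  \<comment> \<open>The bound c / (b + c) forces (b + c) dist y x \<le> c, hence |h y| \<le> |h x| +
    c.\<close>
  define d where "d = min (min d1 d2) (c / (b + c))"
  have "\<bar>f y * h y - f x * h x\<bar> \<le> (a * \<bar>h x\<bar> + \<bar>f x\<bar> * b + \<epsilon>) * dist y x" if "dist y x < d" for y
  proof -
    have 1: "\<bar>f y - f x\<bar> \<le> (a + c) * dist y x" and 2: "\<bar>h y - h x\<bar> \<le> (b + c) * dist y x"
      using d1 d2 that by (auto simp: d_def)
    have "(b + c) * dist y x \<le> c"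
      using that ab c(1) by (simp add: d_def field_simps)
    then have 3: "\<bar>h y\<bar> \<le> \<bar>h x\<bar> + c" using 2 by linarith
    have "f y * h y - f x * h x = (f y - f x) * h y + f x * (h y - h x)" by (simp add: algebra_simps)
    then have "\<bar>f y * h y - f x * h x\<bar> \<le> \<bar>f y - f x\<bar> * \<bar>h y\<bar> + \<bar>f x\<bar> * \<bar>h y - h x\<bar>"
      by (metis abs_mult abs_triangle_ineq)
    also have "\<dots> \<le> ((a + c) * dist y x) * (\<bar>h x\<bar> + c) + \<bar>f x\<bar> * ((b + c) * dist y x)"
      using 1 2 3 ab c(1) by (intro add_mono mult_mono) auto
    also have "\<dots> = ((a + c) * (\<bar>h x\<bar> + c) + \<bar>f x\<bar> * (b + c)) * dist y x" by (simp add: algebra_simps)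
    also have "\<dots> \<le> (a * \<bar>h x\<bar> + \<bar>f x\<bar> * b + \<epsilon>) * dist y x"
      using c by (intro mult_right_mono) auto
    finally show ?thesis .
  qed
  moreover have "d > 0" using d1 d2 c ab by (simp add: d_def)
  ultimately show "\<exists>d>0. \<forall>y. dist y x < d \<longrightarrow>
      \<bar>f y * h y - f x * h x\<bar> \<le> (a * \<bar>h x\<bar> + \<bar>f x\<bar> * b + \<epsilon>) * dist y x" by blast
qed

lemma slope_le_zero:
  assumes "closed K" "x \<notin> K" "\<And>y. y \<notin> K \<Longrightarrow> v y = 0"
  shows "slope_le v x 0"
proof -
  obtain d where "d > 0" "ball x d \<subseteq> - K"
    using assms(1,2) by (meson ComplI open_Compl open_contains_ball)
  then have "\<forall>y. dist y x < d \<longrightarrow> v y = 0" using assms(3) by (auto simp: dist_commute subset_iff)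
  moreover have "v x = 0" using assms by auto
  ultimately show ?thesis using \<open>d > 0\<close> unfolding slope_le_def by (auto intro!: exI[of _ d])
qed

text \<open>The Gagliardo-Nirenberg inequality for \<open>\<delta>\<^sup>b |u|\<^sup>s\<close>.\<close>

lemma weighted_Sobolev_step:
  fixes \<Omega> :: "'a::euclidean_space set" and b s :: real
  defines "\<kappa> \<equiv> real DIM('a) / (real DIM('a) - 1)"
  assumes dim: "DIM('a) \<ge> 2" and \<Omega>: "open \<Omega>" "bounded \<Omega>" and p: "p > 1" and s: "s > 1"
    and u: "C1_compact_support \<Omega> u G"
  shows "(LINT x|lborel. bdist \<Omega> x powr (b * \<kappa>) * \<bar>u x\<bar> powr (s * \<kappa>)) \<le>
    (s * ((LINT x|lborel. bdist \<Omega> x powr (b * p / (p - 1)) * \<bar>u x\<bar> powr ((s - 1) * p / (p - 1))) powr (1 - 1 / p) *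
       (LINT x|lborel. norm (G x) powr p) powr (1 / p)) +
     \<bar>b\<bar> * (LINT x|lborel. bdist \<Omega> x powr (b - 1) * \<bar>u x\<bar> powr s)) powr \<kappa>"
proof -
  have \<kappa>: "\<kappa> > 0" using dim by (simp add: \<kappa>_def)
  obtain K where K: "compact K" "K \<subseteq> \<Omega>" "\<And>x. x \<notin> K \<Longrightarrow> u x = 0" "\<And>x. x \<notin> K \<Longrightarrow> G x = 0"
    using u unfolding C1_compact_support_def by blast
  note cont = C1_compact_supportD(1,2)[OF u]
  note W = weighted_powr_compact_support[OF \<Omega> u]
  define v where "v = (\<lambda>x. bdist \<Omega> x powr b * \<bar>u x\<bar> powr s)"
  define g1 where "g1 = (\<lambda>x. bdist \<Omega> x powr b * \<bar>u x\<bar> powr (s - 1) * norm (G x))"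
  define g2 where "g2 = (\<lambda>x. bdist \<Omega> x powr (b - 1) * \<bar>u x\<bar> powr s)"
  \<comment> \<open>The upper gradient from the product rule: |u|^s contributes s g1, and \<delta>^b
    contributes |b| g2.\<close>
  define g where "g = (\<lambda>x. s * g1 x + \<bar>b\<bar> * g2 x)"
  have g1c: "continuous_on UNIV g1" unfolding g1_def using s cont by (intro continuous_on_mult W continuous_on_norm) auto
  have g2c: "continuous_on UNIV g2" unfolding g2_def using s by (intro W) auto
  have slope: "slope_le v x (g x)" for x
  proof (cases "x \<in> K")
    case False
    then have "slope_le v x 0" using K by (intro slope_le_zero[of K]) (auto simp: v_def compact_imp_closed)
    then show ?thesis using K False by (simp add: g_def g1_def g2_def)
  next
    case True
    then have x: "x \<in> \<Omega>" using K by auto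
    have d: "bdist \<Omega> x > 0" using bdist_pos[OF \<Omega> x] .
    have "((\<lambda>t. t powr b) has_real_derivative b * bdist \<Omega> x powr (b - 1)) (at (bdist \<Omega> x))"
      using d by (rule has_real_derivative_powr)
    then have 1: "slope_le (\<lambda>y. bdist \<Omega> y powr b) x \<bar>b * bdist \<Omega> x powr (b - 1)\<bar>"
      by (rule slope_le_compose_1_Lipschitz) (simp add: bdist_def infdist_triangle_abs)
    have "((\<lambda>y. \<bar>u y\<bar> powr s) has_derivative (\<lambda>h. (p' * (G x \<bullet> h)))) (at x)"
      if "p' = s * (sgn (u x) * \<bar>u x\<bar> powr (s - 1))" for p'
      using has_derivative_compose[OF C1_compact_supportD(3)[OF u] DERIV_abs_powr[OF s, unfolded has_field_derivative_def]] that
      by simp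
    then have "((\<lambda>y. \<bar>u y\<bar> powr s) has_derivative (\<lambda>h. ((s * (sgn (u x) * \<bar>u x\<bar> powr (s - 1))) *\<^sub>R G x) \<bullet> h)) (at x)"
      by simp
    then have 2: "slope_le (\<lambda>y. \<bar>u y\<bar> powr s) x (norm ((s * (sgn (u x) * \<bar>u x\<bar> powr (s - 1))) *\<^sub>R G x))"
      by (rule slope_le_has_derivative)
    have E: "norm ((s * (sgn (u x) * \<bar>u x\<bar> powr (s - 1))) *\<^sub>R G x) = s * (\<bar>u x\<bar> powr (s - 1) * norm (G x))"
      using s by (cases "u x = 0") (auto simp: abs_mult abs_sgn_eq)
    have "slope_le v x (\<bar>b * bdist \<Omega> x powr (b - 1)\<bar> * \<bar>\<bar>u x\<bar> powr s\<bar> +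
        \<bar>bdist \<Omega> x powr b\<bar> * (s * (\<bar>u x\<bar> powr (s - 1) * norm (G x))))"
      unfolding v_def using slope_le_mult[OF 1 2[unfolded E]] s by simp
    then show ?thesis by (simp add: g_def g1_def g2_def abs_mult algebra_simps)
  qed
  have i: "integrable lborel g1" "integrable lborel g2"
    using g1c g2c K by (auto simp: g1_def g2_def intro!: integrable_continuous_compact_support[OF _ K(1)])
  have "(LINT x|lborel. \<bar>v x\<bar> powr \<kappa>) \<le> (LINT x|lborel. g x) powr \<kappa>"
    unfolding \<kappa>_def
  proof (rule Gagliardo_Nirenberg[OF dim])
    show "continuous_on UNIV v" unfolding v_def using s by (intro W) auto
    show "continuous_on UNIV g" unfolding g_def using g1c g2c by (intro continuous_intros)
    show "v x = 0" "g x = 0" if "x \<notin> K" for x using K(3)[OF that] by (auto simp: v_def g_def g1_def g2_def)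
  qed (use s K slope in \<open>auto simp: g_def g1_def g2_def\<close>)
  moreover have "\<bar>v x\<bar> powr \<kappa> = bdist \<Omega> x powr (b * \<kappa>) * \<bar>u x\<bar> powr (s * \<kappa>)" for x
    by (simp add: v_def abs_mult powr_mult powr_powr)
  moreover have "(LINT x|lborel. g x) = s * (LINT x|lborel. g1 x) + \<bar>b\<bar> * (LINT x|lborel. g2 x)"
    unfolding g_def using i by simp
  moreover have "(LINT x|lborel. g1 x) \<le>
     (LINT x|lborel. bdist \<Omega> x powr (b * p / (p - 1)) * \<bar>u x\<bar> powr ((s - 1) * p / (p - 1))) powr (1 - 1 / p) *
       (LINT x|lborel. norm (G x) powr p) powr (1 / p)"
  proof -
    define f1 where "f1 = (\<lambda>x. bdist \<Omega> x powr (b * p / (p - 1)) * \<bar>u x\<bar> powr ((s - 1) * p / (p - 1)))"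
    \<comment> \<open>The exponents of \<open>f1\<close> are those of \<delta> and |u| in
      \<open>g1\<close> divided by 1 - 1/p, ready for Hoelder against the gradient.\<close>
    have e: "c * p / (p - 1) * (1 - 1 / p) = c" for c using p by (simp add: field_simps)
    have "g1 x = f1 x powr (1 - 1 / p) * (norm (G x) powr p) powr (1 / p)" for x
      unfolding g1_def f1_def powr_mult powr_powr e using p by simp
    moreover have "(LINT x|lborel. f1 x powr (1 - 1 / p) * (norm (G x) powr p) powr (1 / p))
        \<le> (LINT x|lborel. f1 x) powr (1 - 1 / p) * (LINT x|lborel. norm (G x) powr p) powr (1 / p)"
      using p s unfolding f1_def
      by (intro Holder_integral W integrable_norm_gradient[OF u]) auto
    ultimately show ?thesis by (simp add: f1_def)
  qed
  moreover have "(LINT x|lborel. g2 x) \<ge> 0" "(LINT x|lborel. g1 x) \<ge> 0"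
    by (auto simp: g1_def g2_def intro!: integral_nonneg_AE)
  ultimately have "(LINT x|lborel. bdist \<Omega> x powr (b * \<kappa>) * \<bar>u x\<bar> powr (s * \<kappa>)) \<le>
      (s * (LINT x|lborel. g1 x) + \<bar>b\<bar> * (LINT x|lborel. g2 x)) powr \<kappa>" by simp
  also have "\<dots> \<le> (s * ((LINT x|lborel. bdist \<Omega> x powr (b * p / (p - 1)) * \<bar>u x\<bar> powr ((s - 1) * p / (p - 1))) powr (1 - 1 / p) *
       (LINT x|lborel. norm (G x) powr p) powr (1 / p)) + \<bar>b\<bar> * (LINT x|lborel. g2 x)) powr \<kappa>"
    using s \<kappa> \<open>(LINT x|lborel. g2 x) \<ge> 0\<close> \<open>(LINT x|lborel. g1 x) \<ge> 0\<close> \<open>(LINT x|lborel. g1 x) \<le> _\<close>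
    by (intro powr_mono2 add_mono mult_left_mono) auto
  finally show ?thesis by (simp only: g2_def)
qed

section \<open>The family of Hardy-Sobolev inequalities and its two endpoints\<close>

text \<open>The power q/p makes both sides homogeneous of degree q in u, so interpolation and
  iteration preserve this form.\<close>

definition Hardy_Sobolev_on :: "'a::euclidean_space set \<Rightarrow> real \<Rightarrow> real \<Rightarrow> real \<Rightarrow> bool" where
  "Hardy_Sobolev_on \<Omega> p a q \<longleftrightarrow> (\<exists>C\<ge>0. \<forall>u G. C1_compact_support \<Omega> u G \<longrightarrow>
     (LINT x|lborel. bdist \<Omega> x powr a * \<bar>u x\<bar> powr q) \<le> C * (LINT x|lborel. norm (G x) powr p) powr (q / p))"

text \<open>Hoelder with exponents 1 - t and t; the weight exponent, the power of u and the power of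
  the right-hand side are all affine in t.\<close>

lemma Hardy_Sobolev_on_interpolate:
  fixes \<Omega> :: "'a::euclidean_space set"
  assumes \<Omega>: "open \<Omega>" "bounded \<Omega>" and H: "Hardy_Sobolev_on \<Omega> p a0 q0" "Hardy_Sobolev_on \<Omega> p a1 q1"
    and q: "q0 > 0" "q1 > 0" and t: "0 \<le> t" "t \<le> 1"
  shows "Hardy_Sobolev_on \<Omega> p ((1 - t) * a0 + t * a1) ((1 - t) * q0 + t * q1)"
proof -
  let ?I = "\<lambda>u a q. LINT x|lborel. bdist \<Omega> x powr a * \<bar>u x\<bar> powr q"
  let ?B = "\<lambda>G. LINT x|lborel. norm (G x :: 'a) powr p"
  obtain C0 where C0: "C0 \<ge> 0" "\<And>u G. C1_compact_support \<Omega> u G \<Longrightarrow> ?I u a0 q0 \<le> C0 * ?B G powr (q0 / p)"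
    using H(1) unfolding Hardy_Sobolev_on_def by blast
  obtain C1 where C1: "C1 \<ge> 0" "\<And>u G. C1_compact_support \<Omega> u G \<Longrightarrow> ?I u a1 q1 \<le> C1 * ?B G powr (q1 / p)"
    using H(2) unfolding Hardy_Sobolev_on_def by blast
  have "?I u ((1 - t) * a0 + t * a1) ((1 - t) * q0 + t * q1)
      \<le> C0 powr (1 - t) * C1 powr t * ?B G powr (((1 - t) * q0 + t * q1) / p)"
    if u: "C1_compact_support \<Omega> u G" for u G
  proof -
    have "bdist \<Omega> x powr ((1 - t) * a0 + t * a1) * \<bar>u x\<bar> powr ((1 - t) * q0 + t * q1)
        = (bdist \<Omega> x powr a0 * \<bar>u x\<bar> powr q0) powr (1 - t) * (bdist \<Omega> x powr a1 * \<bar>u x\<bar> powr q1) powr t" for x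
      by (simp add: powr_mult powr_powr powr_add mult_ac)
    then have "?I u ((1 - t) * a0 + t * a1) ((1 - t) * q0 + t * q1) =
      (LINT x|lborel. (bdist \<Omega> x powr a0 * \<bar>u x\<bar> powr q0) powr (1 - t) * (bdist \<Omega> x powr a1 * \<bar>u x\<bar> powr q1) powr t)"
      by simp
    also have "\<dots> \<le> ?I u a0 q0 powr (1 - t) * ?I u a1 q1 powr t"
      using t q by (intro Holder_integral weighted_powr_compact_support(2)[OF \<Omega> u]) auto
    also have "\<dots> \<le> (C0 * ?B G powr (q0 / p)) powr (1 - t) * (C1 * ?B G powr (q1 / p)) powr t"
      using t by (intro mult_mono powr_mono2 C0(2)[OF u] C1(2)[OF u]) (auto intro!: integral_nonneg_AE)
    also have "\<dots> = C0 powr (1 - t) * C1 powr t * ?B G powr (((1 - t) * q0 + t * q1) / p)"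
      by (simp add: powr_mult powr_powr powr_add add_divide_distrib mult_ac)
    finally show ?thesis .
  qed
  then show ?thesis unfolding Hardy_Sobolev_on_def by (intro exI[of _ "C0 powr (1 - t) * C1 powr t"]) auto
qed

lemma Hardy_Sobolev_on_Hardy:
  fixes \<Omega> :: "'a::euclidean_space set"
  assumes "open \<Omega>" "bounded \<Omega>" "lipschitz_boundary \<Omega>" "\<Omega> \<noteq> {}" "p > 1"
  shows "Hardy_Sobolev_on \<Omega> p (- p) p"
proof -
  have "p / p = 1" using assms by simp
  then show ?thesis using Hardy[OF assms] by (simp add: Hardy_Sobolev_on_def integral_nonneg_AE del: divide_self_if)
qed

text \<open>\<open>weighted_Sobolev_step\<close> with b = 0. The choice of s makes both s N/(N-1)
  and (s-1) p/(p-1) equal to q, so the same integral X stands on both sides and can be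
  absorbed.\<close>

lemma Hardy_Sobolev_on_Sobolev:
  fixes \<Omega> :: "'a::euclidean_space set"
  defines "N \<equiv> real DIM('a)"
  assumes dim: "DIM('a) \<ge> 2" and \<Omega>: "open \<Omega>" "bounded \<Omega>" and p: "1 < p" "p < N"
  shows "Hardy_Sobolev_on \<Omega> p 0 (p * N / (N - p))"
proof -
  define q where "q = p * N / (N - p)"
  define s where "s = p * (N - 1) / (N - p)"
  have N: "N > 1" "q > 0" using p by (auto simp: q_def)
  have s: "s > 1" using p N by (simp add: s_def field_simps)
  have sk: "s * (N / (N - 1)) = q" using p N by (simp add: s_def q_def)
  have "s - 1 = (p - 1) * N / (N - p)" using p by (simp add: s_def field_simps)
  then have sp: "(s - 1) * p / (p - 1) = q" using p by (simp add: q_def)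
  \<comment> \<open>The power of X that survives the division below.\<close>
  have ex: "(N - 1) / N - (1 - 1 / p) = 1 / q" using p by (simp add: q_def field_simps)
  have "(LINT x|lborel. bdist \<Omega> x powr 0 * \<bar>u x\<bar> powr q) \<le> s powr q * (LINT x|lborel. norm (G x) powr p) powr (q / p)"
    if u: "C1_compact_support \<Omega> u G" for u G
  proof -
    define X where "X = (LINT x|lborel. bdist \<Omega> x powr 0 * \<bar>u x\<bar> powr q)"
    define B where "B = (LINT x|lborel. norm (G x) powr p)"
    have X: "X \<ge> 0" by (simp add: X_def integral_nonneg_AE)
    have B: "B \<ge> 0" by (simp add: B_def)
    have main: "X \<le> (s * (X powr (1 - 1 / p) * B powr (1 / p))) powr (N / (N - 1))"
      using weighted_Sobolev_step[OF dim \<Omega> p(1) s u, of 0] sk sp by (simp add: X_def B_def N_def)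
    have "X \<le> s powr q * B powr (q / p)"
    proof (cases "X = 0")
      case False
      then have X: "X > 0" using X by simp
      have "X powr ((N - 1) / N) \<le> ((s * (X powr (1 - 1 / p) * B powr (1 / p))) powr (N / (N - 1))) powr ((N - 1) / N)"
        using main X N by (intro powr_mono2) auto
      also have "\<dots> = X powr (1 - 1 / p) * (s * B powr (1 / p))"
        using N s by (simp add: powr_powr mult_ac)
      finally have "X powr ((N - 1) / N) / X powr (1 - 1 / p) \<le> s * B powr (1 / p)"
        using X by (simp add: divide_le_eq mult_ac)
      then have "X powr (1 / q) \<le> s * B powr (1 / p)" unfolding ex[symmetric] by (simp add: powr_diff)
      then have "(X powr (1 / q)) powr q \<le> (s * B powr (1 / p)) powr q"
        using N by (intro powr_mono2) auto
      then show ?thesis using X N s by (simp add: powr_powr powr_mult)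
    qed simp
    then show ?thesis unfolding X_def B_def .
  qed
  then show ?thesis unfolding Hardy_Sobolev_on_def q_def[symmetric] by (intro exI[of _ "s powr q"]) auto
qed

text \<open>For \<open>p = N\<close> the weight \<open>\<delta>\<^bsup>-N\<^esup>\<close> is the same for every power of \<open>u\<close>, and each application of
  \<open>weighted_Sobolev_step\<close> raises the power by \<open>\<kappa> = N/(N-1)\<close>.\<close>

lemma Hardy_Sobolev_on_conformal:
  fixes \<Omega> :: "'a::euclidean_space set"
  defines "N \<equiv> real DIM('a)"
  assumes dim: "DIM('a) \<ge> 2" and \<Omega>: "open \<Omega>" "bounded \<Omega>" "lipschitz_boundary \<Omega>" "\<Omega> \<noteq> {}" and q: "q \<ge> N"
  shows "Hardy_Sobolev_on \<Omega> N (- N) q"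
proof -
  have N: "N \<ge> 2" using dim by (simp add: N_def)
  define \<kappa> where "\<kappa> = N / (N - 1)"
  have \<kappa>: "\<kappa> > 1" using N by (simp add: \<kappa>_def)
  have e1: "- (N - 1) * \<kappa> = - N" "- (N - 1) * N / (N - 1) = - N" "- (N - 1) - 1 = - N"
    using N by (auto simp: \<kappa>_def field_simps)
  have base: "Hardy_Sobolev_on \<Omega> N (- N) N" using \<Omega> N by (intro Hardy_Sobolev_on_Hardy) auto
  \<comment> \<open>Interpolating with Hardy's inequality, the case q = N, fills in all powers
    between N and \<open>q1\<close>.\<close>
  have between: "Hardy_Sobolev_on \<Omega> N (- N) r"
    if "Hardy_Sobolev_on \<Omega> N (- N) q1" "N \<le> r" "r \<le> q1" for r q1
  proof (cases "q1 = N")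
    case False
    define t where "t = (r - N) / (q1 - N)"
    have t: "0 \<le> t" "t \<le> 1" and r: "(1 - t) * N + t * q1 = r"
    proof -
      have "t * (q1 - N) = r - N" using that False by (simp add: t_def)
      then show "(1 - t) * N + t * q1 = r" by (simp add: algebra_simps)
    qed (use that False in \<open>auto simp: t_def divide_simps\<close>)
    have "Hardy_Sobolev_on \<Omega> N ((1 - t) * - N + t * - N) ((1 - t) * N + t * q1)"
      using that N t base by (intro Hardy_Sobolev_on_interpolate[OF \<Omega>(1,2)]) auto
    moreover have "(1 - t) * - N + t * - N = - N" by (simp add: algebra_simps)
    ultimately show ?thesis using r by simp
  qed (use that base in simp)
  \<comment> \<open>With b = - (N - 1) and p = N all three weights of
    \<open>weighted_Sobolev_step\<close> become \<delta>^(-N), and s = q / \<kappa> makes the powers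
    of u equal to q on the left and to q - \<kappa> and q / \<kappa> on the right.\<close>
  have step: "Hardy_Sobolev_on \<Omega> N (- N) q"
    if H: "Hardy_Sobolev_on \<Omega> N (- N) (q - \<kappa>)" "Hardy_Sobolev_on \<Omega> N (- N) (q / \<kappa>)" and q: "q > \<kappa>" for q
  proof -
    let ?I = "\<lambda>u q. LINT x|lborel. bdist \<Omega> x powr (- N) * \<bar>u x\<bar> powr q"
    let ?B = "\<lambda>G. LINT x|lborel. norm (G x :: 'a) powr N"
    define s where "s = q / \<kappa>"
    have s: "s > 1" "s * \<kappa> = q" using q \<kappa> by (auto simp: s_def)
    have sp: "(s - 1) * N / (N - 1) = q - \<kappa>"
      using s(2) by (simp add: \<kappa>_def algebra_simps diff_divide_distrib)
    obtain C0 where C0: "C0 \<ge> 0" "\<And>u G. C1_compact_support \<Omega> u G \<Longrightarrow> ?I u (q - \<kappa>) \<le> C0 * ?B G powr ((q - \<kappa>) / N)"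
      using H(1) unfolding Hardy_Sobolev_on_def by blast
    obtain C1 where C1: "C1 \<ge> 0" "\<And>u G. C1_compact_support \<Omega> u G \<Longrightarrow> ?I u s \<le> C1 * ?B G powr (s / N)"
      using H(2) unfolding Hardy_Sobolev_on_def s_def by blast
    have "?I u q \<le> (s * C0 powr (1 - 1 / N) + (N - 1) * C1) powr \<kappa> * ?B G powr (q / N)"
      if u: "C1_compact_support \<Omega> u G" for u G
    proof -
      have "?I u q \<le> (s * (?I u (q - \<kappa>) powr (1 - 1 / N) * ?B G powr (1 / N)) + (N - 1) * ?I u s) powr \<kappa>"
        using weighted_Sobolev_step[OF dim \<Omega>(1,2) _ s(1) u, of N "- (N - 1)"] N
        unfolding N_def[symmetric] \<kappa>_def[symmetric] e1 s(2) sp by simp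
      also have "\<dots> \<le> (s * ((C0 * ?B G powr ((q - \<kappa>) / N)) powr (1 - 1 / N) * ?B G powr (1 / N)) + (N - 1) * (C1 * ?B G powr (s / N))) powr \<kappa>"
        using N s \<kappa> by (intro powr_mono2 add_mono mult_left_mono mult_right_mono C0(2)[OF u] C1(2)[OF u])
          (auto intro!: integral_nonneg_AE add_nonneg_nonneg mult_nonneg_nonneg)
      also have "(C0 * ?B G powr ((q - \<kappa>) / N)) powr (1 - 1 / N) * ?B G powr (1 / N)
          = C0 powr (1 - 1 / N) * ?B G powr (s / N)"
      proof -
        have "(q - \<kappa>) / N * (1 - 1 / N) + 1 / N = s / N"
          using N s(2) by (simp add: sp[symmetric] field_simps)
        then have "?B G powr ((q - \<kappa>) / N * (1 - 1 / N)) * ?B G powr (1 / N) = ?B G powr (s / N)"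
          by (simp only: powr_add[symmetric])
        then show ?thesis by (simp add: powr_mult powr_powr)
      qed
      also have "s * (C0 powr (1 - 1 / N) * ?B G powr (s / N)) + (N - 1) * (C1 * ?B G powr (s / N))
          = (s * C0 powr (1 - 1 / N) + (N - 1) * C1) * ?B G powr (s / N)" by (simp add: algebra_simps)
      also have "\<dots> powr \<kappa> = (s * C0 powr (1 - 1 / N) + (N - 1) * C1) powr \<kappa> * ?B G powr (q / N)"
        using s by (simp add: powr_mult powr_powr)
      finally show ?thesis .
    qed
    then show ?thesis unfolding Hardy_Sobolev_on_def
      by (intro exI[of _ "(s * C0 powr (1 - 1 / N) + (N - 1) * C1) powr \<kappa>"]) auto
  qed
  \<comment> \<open>For q = N + (k+1) \<kappa> the power q - \<kappa> is the previous one, and q /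
    \<kappa> = N + k lies between N and N + k \<kappa>.\<close>
  have *: "Hardy_Sobolev_on \<Omega> N (- N) (N + real k * \<kappa>)" for k
  proof (induction k)
    case (Suc k)
    show ?case
    proof (rule step)
      show "Hardy_Sobolev_on \<Omega> N (- N) (N + real (Suc k) * \<kappa> - \<kappa>)"
        using Suc by (simp add: algebra_simps)
      have "(N + real (Suc k) * \<kappa>) / \<kappa> = N + real k"
        using N by (simp add: \<kappa>_def field_simps)
      then show "Hardy_Sobolev_on \<Omega> N (- N) ((N + real (Suc k) * \<kappa>) / \<kappa>)"
        using \<kappa> mult_left_mono[of 1 \<kappa> "real k"] by (simp, intro between[OF Suc]) auto
      show "N + real (Suc k) * \<kappa> > \<kappa>" using N \<kappa> by (simp add: algebra_simps add_pos_nonneg)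
    qed
  qed (use base in simp)
  obtain k :: nat where "(q - N) / \<kappa> \<le> real k" using real_arch_simple by blast
  then have "q \<le> N + real k * \<kappa>" using \<kappa> by (simp add: field_simps)
  then show ?thesis using between[OF *] q by blast
qed

text \<open>For p < N interpolate between Hardy (t = 0) and Sobolev (t = 1): the upper bound on
  \<beta> says exactly that t \<le> 1. For p = N the weight is \<delta>^(-N) and the power is N +
  \<beta>.\<close>

lemma Hardy_Sobolev_on_general:
  fixes \<Omega> :: "'a::euclidean_space set"
  defines "N \<equiv> real DIM('a)"
  assumes dim: "DIM('a) \<ge> 2" and \<Omega>: "open \<Omega>" "bounded \<Omega>" "lipschitz_boundary \<Omega>" "\<Omega> \<noteq> {}"
    and p: "1 < p" "p \<le> N" and \<beta>: "\<beta> \<ge> 0" "p < N \<Longrightarrow> \<beta> \<le> p * N / (N - p)"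
  shows "Hardy_Sobolev_on \<Omega> p (- p + (N - p) / N * \<beta>) (p + p * \<beta> / N)"
proof (cases "p = N")
  case True
  then show ?thesis using Hardy_Sobolev_on_conformal[OF dim \<Omega>, of "N + \<beta>"] p \<beta> by (simp add: N_def)
next
  case False
  then have pN: "p < N" using p by simp
  define t where "t = \<beta> * (N - p) / (p * N)"
  have "0 \<le> t" using \<beta>(1) pN p by (simp add: t_def)
  moreover have "t \<le> 1" using \<beta>(2)[OF pN] pN p by (simp add: t_def field_simps)
  ultimately have t: "0 \<le> t" "t \<le> 1" by auto
  have "Hardy_Sobolev_on \<Omega> p ((1 - t) * - p + t * 0) ((1 - t) * p + t * (p * N / (N - p)))"
    using p pN t unfolding N_def
    by (intro Hardy_Sobolev_on_interpolate Hardy_Sobolev_on_Hardy Hardy_Sobolev_on_Sobolev \<Omega> dim) auto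
  moreover have "(1 - t) * - p + t * 0 = - p + (N - p) / N * \<beta>"
    using p by (simp add: t_def field_simps)
  moreover have "(1 - t) * p + t * (p * N / (N - p)) = p + p * \<beta> / N"
  proof -
    have "t * (p * N / (N - p)) = \<beta>" using p pN by (simp add: t_def)
    moreover have "t * p = \<beta> - p * \<beta> / N" using p pN by (simp add: t_def field_simps)
    ultimately show ?thesis by (simp add: algebra_simps)
  qed
  ultimately show ?thesis by simp
qed

section \<open>Passage to Sobolev functions\<close>

lemma C1_compact_support_test_function:
  fixes \<phi> :: "'a::euclidean_space \<Rightarrow> real"
  assumes "\<phi> \<in> test_functions \<Omega>"
  shows "C1_compact_support \<Omega> \<phi> (grad \<phi>)"
proof -
  have "C_k 1 \<phi>" and K: "compact (closure {x. \<phi> x \<noteq> 0})" "closure {x. \<phi> x \<noteq> 0} \<subseteq> \<Omega>"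
    using assms by (auto simp: test_functions_def)
  then have d: "\<phi> differentiable (at x)" and c: "b \<in> Basis \<Longrightarrow> continuous_on UNIV (pderiv_dir \<phi> b)" for x b
    by (auto simp: numeral_eq_Suc)
  have fd: "(\<phi> has_derivative frechet_derivative \<phi> (at x)) (at x)" for x
    using d by (rule frechet_derivative_works[THEN iffD1])
  have grad: "grad \<phi> x \<bullet> h = frechet_derivative \<phi> (at x) h" for x h
  proof -
    have l: "linear (frechet_derivative \<phi> (at x))" using fd by (rule has_derivative_linear)
    have "frechet_derivative \<phi> (at x) h = frechet_derivative \<phi> (at x) (\<Sum>b\<in>Basis. (h \<bullet> b) *\<^sub>R b)"
      by (simp add: euclidean_representation)
    also have "\<dots> = (\<Sum>b\<in>Basis. (h \<bullet> b) * frechet_derivative \<phi> (at x) b)"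
      by (simp add: linear_sum[OF l] linear_cmul[OF l])
    also have "\<dots> = (\<Sum>b\<in>Basis. frechet_derivative \<phi> (at x) b * (b \<bullet> h))"
      by (intro sum.cong refl) (simp add: inner_commute)
    finally show ?thesis unfolding grad_def inner_sum_left inner_scaleR_left ..
  qed
  have out: "\<phi> x = 0" if "x \<notin> closure {x. \<phi> x \<noteq> 0}" for x
    using that closure_subset[of "{x. \<phi> x \<noteq> 0}"] by auto
  have out': "grad \<phi> x = 0" if "x \<notin> closure {x. \<phi> x \<noteq> 0}" for x
  proof -
    have "(\<phi> has_derivative (\<lambda>_. 0)) (at x)"
    proof (rule has_derivative_transform_within_open)
      show "((\<lambda>_. 0) has_derivative (\<lambda>_. 0)) (at x)" by (rule has_derivative_const)
      show "open (- closure {x. \<phi> x \<noteq> 0})" by (intro open_Compl closed_closure)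
      show "x \<in> - closure {x. \<phi> x \<noteq> 0}" unfolding Compl_iff by (rule that)
      show "0 = \<phi> y" if "y \<in> - closure {x. \<phi> x \<noteq> 0}" for y
        using out[of y] that by simp
    qed
    then have "frechet_derivative \<phi> (at x) = (\<lambda>_. 0)"
      by (rule has_derivative_unique[OF fd])
    then show ?thesis by (simp add: grad_def)
  qed
  have "continuous_on UNIV (grad \<phi>)"
    unfolding grad_def by (intro continuous_on_sum continuous_on_scaleR continuous_on_const c)
  moreover have "(\<phi> has_derivative (\<lambda>h. grad \<phi> x \<bullet> h)) (at x)" for x
    unfolding grad by (rule fd)
  ultimately show ?thesis
    unfolding C1_compact_support_def
    by (intro conjI allI exI[of _ "closure {x. \<phi> x \<noteq> 0}"] impI K out out')
qed

lemma continuous_imp_borel_measurable_lebesgue: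
  fixes g :: "'a::euclidean_space \<Rightarrow> 'b::euclidean_space"
  assumes "continuous_on UNIV g"
  shows "g \<in> borel_measurable lebesgue"
  using borel_measurable_continuous_onI[OF assms] by (intro measurable_completion) simp

lemma Lp_space_diff_continuous:
  fixes f g :: "'a::euclidean_space \<Rightarrow> 'b::euclidean_space"
  assumes f: "f \<in> Lp_space \<Omega> p" and g: "continuous_on UNIV g" "integrable lborel (\<lambda>x. norm (g x) powr p)"
    and \<Omega>: "open \<Omega>" and p: "p > 0"
  shows "set_integrable lebesgue \<Omega> (\<lambda>x. norm (f x - g x) powr p)"
proof -
  have \<Omega>': "\<Omega> \<in> sets lebesgue" using \<Omega> by simp
  have fm[measurable]: "(\<lambda>x. indicator \<Omega> x *\<^sub>R f x) \<in> borel_measurable lebesgue"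
    using f by (simp add: Lp_space_def set_borel_measurable_def)
  have gm[measurable]: "g \<in> borel_measurable lebesgue"
    using g(1) by (rule continuous_imp_borel_measurable_lebesgue)
  have gi: "set_integrable lebesgue \<Omega> (\<lambda>x. norm (g x) powr p)"
    using integrable_mult_indicator[OF \<Omega>' integrable_completion[THEN iffD2, OF _ g(2)]] g(2)
    unfolding set_integrable_def by auto
  have fi: "set_integrable lebesgue \<Omega> (\<lambda>x. norm (f x) powr p)"
    using f by (simp add: Lp_space_def)
  have "set_integrable lebesgue \<Omega> (\<lambda>x. 2 powr p * (norm (f x) powr p + norm (g x) powr p))"
    using fi gi by (intro set_integrable_mult_right set_integral_add)
  then show ?thesis
    unfolding set_integrable_def
  proof (rule Bochner_Integration.integrable_bound)
    \<comment> \<open>Measurability of f is known only after cutting off at \<open>\<Omega>\<close>,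
      so the indicator is moved inside the norm.\<close>
    have "(\<lambda>x. indicator \<Omega> x *\<^sub>R norm (f x - g x) powr p)
        = (\<lambda>x. indicator \<Omega> x * norm (indicator \<Omega> x *\<^sub>R f x - g x) powr p)"
      by (auto simp: indicator_def)
    then show "(\<lambda>x. indicator \<Omega> x *\<^sub>R norm (f x - g x) powr p) \<in> borel_measurable lebesgue"
      using \<Omega>' by simp
    show "AE x in lebesgue. norm (indicator \<Omega> x *\<^sub>R norm (f x - g x) powr p)
        \<le> norm (indicator \<Omega> x *\<^sub>R (2 powr p * (norm (f x) powr p + norm (g x) powr p)))"
    proof (intro AE_I2)
      fix x
      have "norm (f x - g x) powr p \<le> (norm (f x) + norm (g x)) powr p"
        using p by (intro powr_mono2 norm_triangle_ineq4) auto
      also have "\<dots> \<le> 2 powr p * (norm (f x) powr p + norm (g x) powr p)"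
        using p by (intro powr_add_le) auto
      finally show "norm (indicator \<Omega> x *\<^sub>R norm (f x - g x) powr p)
        \<le> norm (indicator \<Omega> x *\<^sub>R (2 powr p * (norm (f x) powr p + norm (g x) powr p)))"
        by (auto simp: indicator_def abs_mult)
    qed
  qed
qed

lemma Lp_norm_tendsto_0D:
  assumes "(\<lambda>k. Lp_norm \<Omega> p (f k)) \<longlonglongrightarrow> 0" "p > 0"
  shows "(\<lambda>k. LINT x:\<Omega>|lebesgue. norm (f k x) powr p) \<longlonglongrightarrow> 0"
proof -
  have nn: "(LINT x:\<Omega>|lebesgue. norm (f k x) powr p) \<ge> 0" for k
    unfolding set_lebesgue_integral_def by (intro integral_nonneg_AE) auto
  have "(\<lambda>k. Lp_norm \<Omega> p (f k) powr p) \<longlonglongrightarrow> 0 powr p"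
    using assms by (intro tendsto_powr2) (auto simp: Lp_norm_def)
  then show ?thesis using nn assms(2) by (simp add: Lp_norm_def powr_powr)
qed

lemma powr_abs_tendsto_0D:
  fixes f :: "nat \<Rightarrow> real"
  assumes "(\<lambda>k. \<bar>f k\<bar> powr p) \<longlonglongrightarrow> 0" "p > 0"
  shows "f \<longlonglongrightarrow> 0"
proof -
  have "(\<lambda>k. (\<bar>f k\<bar> powr p) powr (1 / p)) \<longlonglongrightarrow> 0 powr (1 / p)"
    using assms by (intro tendsto_powr2) auto
  then have "(\<lambda>k. \<bar>f k\<bar>) \<longlonglongrightarrow> 0" using assms(2) by (simp add: powr_powr)
  then show ?thesis by (rule tendsto_rabs_zero_cancel)
qed

text \<open>The inequality holds for approximating test functions, whose gradient integrals stay
  bounded; Fatou's lemma gives both integrability and the estimate for u. The factor 2^p comes from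
  splitting the gradient by the triangle inequality.\<close>

lemma Hardy_Sobolev_on_imp_sobolev_W1_0:
  fixes \<Omega> :: "'a::euclidean_space set"
  assumes \<Omega>: "open \<Omega>" "bounded \<Omega>" and p: "p > 1" and q: "q > 0" and H: "Hardy_Sobolev_on \<Omega> p a q"
  shows "\<exists>C>0. \<forall>u\<in>sobolev_W1_0 \<Omega> p.
    set_integrable lebesgue \<Omega> (\<lambda>x. bdist \<Omega> x powr a * \<bar>u x\<bar> powr q) \<and>
    (LINT x:\<Omega>|lebesgue. bdist \<Omega> x powr a * \<bar>u x\<bar> powr q) powr (p / q)
      \<le> C * (LINT x:\<Omega>|lebesgue. norm (weak_grad \<Omega> u x) powr p)"
proof -
  obtain C where C: "C \<ge> 0" "\<And>u G. C1_compact_support \<Omega> u G \<Longrightarrow>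
     (LINT x|lborel. bdist \<Omega> x powr a * \<bar>u x\<bar> powr q) \<le> C * (LINT x|lborel. norm (G x) powr p) powr (q / p)"
    using H unfolding Hardy_Sobolev_on_def by blast
  have \<Omega>'[measurable]: "\<Omega> \<in> sets lebesgue" using \<Omega> by simp
  have main: "set_integrable lebesgue \<Omega> (\<lambda>x. bdist \<Omega> x powr a * \<bar>u x\<bar> powr q) \<and>
     (LINT x:\<Omega>|lebesgue. bdist \<Omega> x powr a * \<bar>u x\<bar> powr q)
      \<le> C * (2 powr p * (LINT x:\<Omega>|lebesgue. norm (weak_grad \<Omega> u x) powr p)) powr (q / p)"
    if u: "u \<in> sobolev_W1_0 \<Omega> p" for u
  proof -
    define W where "W = weak_grad \<Omega> u"
    obtain \<phi> where \<phi>: "\<And>k. \<phi> k \<in> test_functions \<Omega>"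
      and uL: "u \<in> Lp_space \<Omega> p" and WL: "W \<in> Lp_space \<Omega> p"
      and lim_u: "(\<lambda>k. Lp_norm \<Omega> p (\<lambda>x. u x - \<phi> k x)) \<longlonglongrightarrow> 0"
      and lim_W: "(\<lambda>k. Lp_norm \<Omega> p (\<lambda>x. W x - grad (\<phi> k) x)) \<longlonglongrightarrow> 0"
    proof -
      have "u \<in> sobolev_W1 \<Omega> p" using u by (simp add: sobolev_W1_0_def)
      then have L: "u \<in> Lp_space \<Omega> p" "W \<in> Lp_space \<Omega> p" by (simp_all add: sobolev_W1_def W_def)
      have "\<exists>\<phi>. (\<forall>k. \<phi> k \<in> test_functions \<Omega>) \<and> (\<lambda>k. Lp_norm \<Omega> p (\<lambda>x. u x - \<phi> k x)) \<longlonglongrightarrow> 0 \<and>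
          (\<lambda>k. Lp_norm \<Omega> p (\<lambda>x. W x - grad (\<phi> k) x)) \<longlonglongrightarrow> 0"
        using u by (simp add: sobolev_W1_0_def W_def)
      then show ?thesis using L that by blast
    qed
    note C1 = C1_compact_support_test_function[OF \<phi>]
    note cont = C1_compact_supportD(1,2)[OF C1]
    have um[measurable]: "(\<lambda>x. indicator \<Omega> x *\<^sub>R u x) \<in> borel_measurable lebesgue"
      using uL by (simp add: Lp_space_def set_borel_measurable_def)
    define Y where "Y = (LINT x:\<Omega>|lebesgue. norm (W x) powr p)"
    define Z where "Z = (\<lambda>k. LINT x:\<Omega>|lebesgue. norm (W x - grad (\<phi> k) x) powr p)"
    have Y: "Y \<ge> 0" and Znn: "Z k \<ge> 0" for k
      unfolding Y_def Z_def set_lebesgue_integral_def by (auto intro!: integral_nonneg_AE)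
    have Z: "Z \<longlonglongrightarrow> 0" unfolding Z_def using lim_W p by (intro Lp_norm_tendsto_0D) auto
    define B where "B = (\<lambda>k. LINT x|lborel. norm (grad (\<phi> k) x) powr p)"
    have B: "B k \<le> 2 powr p * (Y + Z k)" for k
    proof -
      have Wi: "set_integrable lebesgue \<Omega> (\<lambda>x. norm (W x) powr p)"
        using WL by (simp add: Lp_space_def)
      have Di: "set_integrable lebesgue \<Omega> (\<lambda>x. norm (W x - grad (\<phi> k) x) powr p)"
        using p by (intro Lp_space_diff_continuous WL cont \<Omega> integrable_norm_gradient[OF C1]) auto
      have Gi: "integrable lborel (\<lambda>x. norm (grad (\<phi> k) x) powr p)"
        using p by (intro integrable_norm_gradient[OF C1]) auto
      have "B k = (LINT x|lebesgue. norm (grad (\<phi> k) x) powr p)"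
        unfolding B_def using Gi by (intro integral_completion[symmetric]) auto
      also have "\<dots> \<le> (LINT x:\<Omega>|lebesgue. 2 powr p * (norm (W x) powr p + norm (W x - grad (\<phi> k) x) powr p))"
        unfolding set_lebesgue_integral_def
      proof (rule integral_mono)
        show "integrable lebesgue (\<lambda>x. norm (grad (\<phi> k) x) powr p)"
          using Gi by (subst integrable_completion) auto
        show "integrable lebesgue (\<lambda>x. indicator \<Omega> x *\<^sub>R (2 powr p * (norm (W x) powr p + norm (W x - grad (\<phi> k) x) powr p)))"
          using Wi Di unfolding set_integrable_def[symmetric]
          by (intro set_integrable_mult_right set_integral_add)
        fix x
        show "norm (grad (\<phi> k) x) powr p \<le> indicator \<Omega> x *\<^sub>R (2 powr p * (norm (W x) powr p + norm (W x - grad (\<phi> k) x) powr p))"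
        proof (cases "x \<in> \<Omega>")
          case True
          have "norm (grad (\<phi> k) x) \<le> norm (W x) + norm (W x - grad (\<phi> k) x)"
            using norm_triangle_ineq4[of "W x" "W x - grad (\<phi> k) x"] by simp
          then have "norm (grad (\<phi> k) x) powr p \<le> (norm (W x) + norm (W x - grad (\<phi> k) x)) powr p"
            using p by (intro powr_mono2) auto
          also have "\<dots> \<le> 2 powr p * (norm (W x) powr p + norm (W x - grad (\<phi> k) x) powr p)"
            using p by (intro powr_add_le) auto
          finally show ?thesis using True by simp
        qed (use C1_compact_supportD(5)[OF C1] in simp)
      qed
      also have "\<dots> = 2 powr p * (Y + Z k)"
        unfolding Y_def Z_def using Wi Di by (simp add: set_integral_add)
      finally show ?thesis .
    qed
    have "\<exists>r::nat \<Rightarrow> nat. strict_mono r \<and>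
        (AE x in lebesgue. (\<lambda>k. indicator \<Omega> x *\<^sub>R norm (u x - \<phi> (r k) x) powr p) \<longlonglongrightarrow> 0)"
    proof (rule tendsto_L1_AE_subseq)
      show "integrable lebesgue (\<lambda>x. indicator \<Omega> x *\<^sub>R norm (u x - \<phi> k x) powr p)" for k
        unfolding set_integrable_def[symmetric]
        using p integrable_norm_gradient(3)[OF C1]
        by (intro Lp_space_diff_continuous uL cont \<Omega>) auto
      have "(\<lambda>k. LINT x:\<Omega>|lebesgue. norm (u x - \<phi> k x) powr p) \<longlonglongrightarrow> 0"
        using lim_u p by (intro Lp_norm_tendsto_0D) auto
      then show "(\<lambda>k. LINT x|lebesgue. norm (indicator \<Omega> x *\<^sub>R norm (u x - \<phi> k x) powr p)) \<longlonglongrightarrow> 0"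
        by (simp add: set_lebesgue_integral_def)
    qed
    then obtain r :: "nat \<Rightarrow> nat" where r: "strict_mono r"
      "AE x in lebesgue. (\<lambda>k. indicator \<Omega> x *\<^sub>R norm (u x - \<phi> (r k) x) powr p) \<longlonglongrightarrow> 0" by blast
    define f where "f = (\<lambda>k x. bdist \<Omega> x powr a * \<bar>\<phi> (r k) x\<bar> powr q)"
    \<comment> \<open>The indicator fixes the integrand outside \<open>\<Omega>\<close>, where the
      representative u is arbitrary.\<close>
    define F where "F = (\<lambda>x. indicator \<Omega> x * (bdist \<Omega> x powr a * \<bar>u x\<bar> powr q))"
    have fc: "continuous_on UNIV (f k)" "integrable lborel (f k)" for k
      unfolding f_def using weighted_powr_compact_support[OF \<Omega> C1 q] by auto
    have fm[measurable]: "f k \<in> borel_measurable lebesgue" for k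
      using fc(1) by (rule continuous_imp_borel_measurable_lebesgue)
    have f_lim: "AE x in lebesgue. (\<lambda>k. f k x) \<longlonglongrightarrow> F x"
      using r(2)
    proof eventually_elim
      case (elim x)
      show ?case
      proof (cases "x \<in> \<Omega>")
        case True
        then have "(\<lambda>k. \<bar>u x - \<phi> (r k) x\<bar> powr p) \<longlonglongrightarrow> 0"
          using elim by (simp only: indicator_simps(1) scaleR_one real_norm_def)
        then have "(\<lambda>k. u x - \<phi> (r k) x) \<longlonglongrightarrow> 0" by (rule powr_abs_tendsto_0D) (use p in simp)
        from tendsto_diff[OF tendsto_const[of "u x"] this]
        have "(\<lambda>k. \<phi> (r k) x) \<longlonglongrightarrow> u x" by simp
        then have "(\<lambda>k. \<bar>\<phi> (r k) x\<bar> powr q) \<longlonglongrightarrow> \<bar>u x\<bar> powr q"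
          using q by (intro tendsto_powr2 tendsto_rabs tendsto_const) auto
        then have "(\<lambda>k. f k x) \<longlonglongrightarrow> bdist \<Omega> x powr a * \<bar>u x\<bar> powr q"
          unfolding f_def by (rule tendsto_mult_left)
        then show ?thesis using True by (simp add: F_def)
      next
        case False
        then have "\<phi> (r k) x = 0" for k by (intro C1_compact_supportD(4)[OF C1])
        then have "f k x = F x" for k using False q by (simp add: f_def F_def)
        then show ?thesis by simp
      qed
    qed
    have Fm: "F \<in> borel_measurable lebesgue"
    proof -
      have [measurable]: "bdist \<Omega> \<in> borel_measurable lebesgue"
        unfolding bdist_def by (intro continuous_imp_borel_measurable_lebesgue continuous_intros)
      have *: "F = (\<lambda>x. bdist \<Omega> x powr a * \<bar>indicator \<Omega> x *\<^sub>R u x\<bar> powr q)"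
        by (auto simp: F_def indicator_def)
      show ?thesis unfolding * by measurable
    qed
    have Fnn: "F x \<ge> 0" for x by (simp add: F_def)
    \<comment> \<open>The limit of the bounds for the approximants, since \<open>Z\<close> tends to
      0 along the subsequence.\<close>
    define D where "D = C * (2 powr p * Y) powr (q / p)"
    have "(\<integral>\<^sup>+x. ennreal (F x) \<partial>lebesgue) = (\<integral>\<^sup>+x. liminf (\<lambda>k. ennreal (f k x)) \<partial>lebesgue)"
    proof (intro nn_integral_cong_AE)
      show "AE x in lebesgue. ennreal (F x) = liminf (\<lambda>k. ennreal (f k x))"
        using f_lim
      proof eventually_elim
        case (elim x)
        then have "(\<lambda>k. ennreal (f k x)) \<longlonglongrightarrow> ennreal (F x)" by (rule tendsto_ennrealI)
        then show ?case by (intro lim_imp_Liminf[symmetric]) auto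
      qed
    qed
    also have "\<dots> \<le> liminf (\<lambda>k. \<integral>\<^sup>+x. ennreal (f k x) \<partial>lebesgue)"
      by (intro nn_integral_liminf) auto
    also have "\<dots> \<le> liminf (\<lambda>k. ennreal (C * (2 powr p * (Y + Z (r k))) powr (q / p)))"
    proof (intro Liminf_mono always_eventually allI)
      fix k
      have "(\<integral>\<^sup>+x. ennreal (f k x) \<partial>lebesgue) = (\<integral>\<^sup>+x. ennreal (f k x) \<partial>lborel)"
        by (intro nn_integral_completion)
      also have "\<dots> = ennreal (LINT x|lborel. f k x)"
        using fc(2) by (intro nn_integral_eq_integral) (auto simp: f_def)
      also have "\<dots> \<le> ennreal (C * (2 powr p * (Y + Z (r k))) powr (q / p))"
      proof (intro ennreal_leI)
        have "(LINT x|lborel. f k x) \<le> C * B (r k) powr (q / p)"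
          unfolding f_def B_def by (rule C(2)[OF C1])
        also have "\<dots> \<le> C * (2 powr p * (Y + Z (r k))) powr (q / p)"
          using B[of "r k"] C(1) p q by (intro mult_left_mono powr_mono2) (auto simp: B_def)
        finally show "(LINT x|lborel. f k x) \<le> C * (2 powr p * (Y + Z (r k))) powr (q / p)" .
      qed
      finally show "(\<integral>\<^sup>+x. ennreal (f k x) \<partial>lebesgue) \<le> ennreal (C * (2 powr p * (Y + Z (r k))) powr (q / p))" .
    qed
    also have "\<dots> = ennreal D"
    proof (intro lim_imp_Liminf tendsto_ennrealI)
      have "(\<lambda>k. Z (r k)) \<longlonglongrightarrow> 0" using LIMSEQ_subseq_LIMSEQ[OF Z r(1)] by (simp add: o_def)
      then have "(\<lambda>k. C * (2 powr p * (Y + Z (r k))) powr (q / p)) \<longlonglongrightarrow> C * (2 powr p * (Y + 0)) powr (q / p)"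
        using Y Znn p q by (intro tendsto_mult tendsto_const tendsto_powr2 tendsto_add) auto
      then show "(\<lambda>k. C * (2 powr p * (Y + Z (r k))) powr (q / p)) \<longlonglongrightarrow> D" by (simp add: D_def)
    qed auto
    finally have le: "(\<integral>\<^sup>+x. ennreal (F x) \<partial>lebesgue) \<le> ennreal D" .
    have "(\<integral>\<^sup>+x. ennreal (F x) \<partial>lebesgue) < \<infinity>"
      by (rule le_less_trans[OF le]) simp
    then have Fi: "integrable lebesgue F" using Fm Fnn by (intro integrableI_nonneg) auto
    have "D \<ge> 0" using C(1) by (simp add: D_def)
    then have "(LINT x|lebesgue. F x) \<le> D"
      using le Fi Fnn by (simp add: nn_integral_eq_integral)
    with Fi show ?thesis
      by (simp add: F_def D_def Y_def W_def set_integrable_def set_lebesgue_integral_def)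
  qed
  \<comment> \<open>The summand 1 keeps the constant positive even if C = 0.\<close>
  define C' where "C' = C powr (p / q) * 2 powr p + 1"
  have "set_integrable lebesgue \<Omega> (\<lambda>x. bdist \<Omega> x powr a * \<bar>u x\<bar> powr q) \<and>
    (LINT x:\<Omega>|lebesgue. bdist \<Omega> x powr a * \<bar>u x\<bar> powr q) powr (p / q)
      \<le> C' * (LINT x:\<Omega>|lebesgue. norm (weak_grad \<Omega> u x) powr p)"
    if u: "u \<in> sobolev_W1_0 \<Omega> p" for u
  proof (intro conjI)
    define Y where "Y = (LINT x:\<Omega>|lebesgue. norm (weak_grad \<Omega> u x) powr p)"
    have Y: "Y \<ge> 0" unfolding Y_def set_lebesgue_integral_def by (auto intro!: integral_nonneg_AE)
    have "(LINT x:\<Omega>|lebesgue. bdist \<Omega> x powr a * \<bar>u x\<bar> powr q) powr (p / q)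
        \<le> (C * (2 powr p * Y) powr (q / p)) powr (p / q)"
      using main[OF u] p q unfolding Y_def
      by (intro powr_mono2) (auto simp: set_lebesgue_integral_def intro!: integral_nonneg_AE)
    also have "\<dots> = C powr (p / q) * (2 powr p * Y)"
      using p q Y by (simp add: powr_mult powr_powr)
    also have "\<dots> \<le> C' * Y" using Y by (simp add: C'_def algebra_simps)
    finally show "(LINT x:\<Omega>|lebesgue. bdist \<Omega> x powr a * \<bar>u x\<bar> powr q) powr (p / q) \<le> C' * Y" .
  qed (use main[OF u] in blast)
  moreover have "C' > 0" by (simp add: C'_def add_nonneg_pos)
  ultimately show ?thesis by blast
qed

text \<open>Integrability is asserted along with the estimate: the integral of a non-integrable
  function is 0 by convention, and the estimate alone would then say nothing.\<close>

theorem theorem1p1: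
  fixes n :: nat and p \<beta> :: real and \<Omega> :: "(real ^ 'd) set"
  assumes "n \<ge> 1" and "CARD('d) = n + 1"
    and "bounded_lipschitz_domain \<Omega>"
    and "1 < p" and "p \<le> real n + 1"
    and "0 \<le> \<beta>"
    and "p < real n + 1 \<Longrightarrow> \<beta> \<le> p * (real n + 1) / (real n + 1 - p)"
  shows "\<exists>C>0. \<forall>u\<in>sobolev_W1_0 \<Omega> p.
    set_integrable lebesgue \<Omega>
      (\<lambda>x. bdist \<Omega> x powr (- p + (real n + 1 - p) / (real n + 1) * \<beta>) *
            \<bar>u x\<bar> powr (p + p * \<beta> / (real n + 1))) \<and>
    (LINT x:\<Omega>|lebesgue.
       bdist \<Omega> x powr (- p + (real n + 1 - p) / (real n + 1) * \<beta>) *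
       \<bar>u x\<bar> powr (p + p * \<beta> / (real n + 1))) powr ((real n + 1) / (real n + \<beta> + 1))
    \<le> C * (LINT x:\<Omega>|lebesgue. norm (weak_grad \<Omega> u x) powr p)"
proof -
  have \<Omega>: "open \<Omega>" "bounded \<Omega>" "lipschitz_boundary \<Omega>" "\<Omega> \<noteq> {}"
    using assms(3) by (auto simp: bounded_lipschitz_domain_def)
  have N: "real DIM(real ^ 'd) = real n + 1" "DIM(real ^ 'd) \<ge> 2" using assms by auto
  have H: "Hardy_Sobolev_on \<Omega> p (- p + (real n + 1 - p) / (real n + 1) * \<beta>) (p + p * \<beta> / (real n + 1))"
    using Hardy_Sobolev_on_general[OF N(2) \<Omega> assms(4), of \<beta>] assms unfolding N(1) by simp
  have pos: "p + p * \<beta> / (real n + 1) > 0" using assms by (intro add_pos_nonneg) auto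
  \<comment> \<open>The outer exponent is p/q, where q is the power of |u|; it brings both sides to
    degree p.\<close>
  have e: "p / (p + p * \<beta> / (real n + 1)) = (real n + 1) / (real n + \<beta> + 1)"
  proof -
    have "p + p * \<beta> / (real n + 1) = p * ((real n + \<beta> + 1) / (real n + 1))"
      by (simp add: field_simps)
    then show ?thesis using assms by simp
  qed
  show ?thesis
    using Hardy_Sobolev_on_imp_sobolev_W1_0[OF \<Omega>(1,2) assms(4) pos H] unfolding e .
qed

end
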